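(* Let $\lambda_1,\lambda_2\in[0,1]$. If $G_1$ is an $(N_1,D_1,\lambda_1)$-graph on $[N_1]$ and $G_2$ is a $(D_1,D_2,\lambda_2)$-graph on $[D_1]$, then their replacement product $G$ is an $(N_1\cdot D_1,\,D_2+1,\,g(\lambda_1,\lambda_2,D_2))$-graph, where $$g(\lambda_1,\lambda_2,D_2)\le\bigl((1-p)+p\,f(\lambda_1,\lambda_2)\bigr)^{1/3},\qquad p=\frac{D_2^2}{(D_2+1)^3},$$ and $f(\lambda_1,\lambda_2)=\frac12(1-\lambda_2^2)\lambda_1+\frac12\sqrt{(1-\lambda_2^2)^2\lambda_1^2+4\lambda_2^2}$. In particular, $g(\lambda_1,\lambda_2,D_2)<1$ when $\lambda_1,\lambda_2<1$. Moreover, $\mathrm{Rot}_{G}$ can be computed in time $\mathrm{poly}(\log N_1,\log D_1,\log D_2)$ with one oracle query to $\mathrm{Rot}_{G_1}$ or $\mathrm{Rot}_{G_2}$.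
   Context: For a positive integer $n$, $[n]=\{1,\dots,n\}$. Graphs are finite, undirected and regular, and may have self-loops and parallel edges. A $D$-regular graph $G$ on $[N]$ is specified by its rotation map $\mathrm{Rot}_G:[N]\times[D]\to[N]\times[D]$: $\mathrm{Rot}_G(v,i)=(w,j)$ means that the $i$-th edge incident to $v$ leads to $w$ and that this edge is the $j$-th edge incident to $w$. Thus $\mathrm{Rot}_G$ is a permutation with $\mathrm{Rot}_G\circ\mathrm{Rot}_G=\mathrm{id}$ (and any such involution specifies a $D$-regular graph). Vertex sets and sets of edge labels may be any finite sets of the right cardinality. The normalized adjacency matrix of $G$ is the symmetric $N\times N$ matrix with $M_{u,v}=\frac1D|\{(i,j)\in[D]^2:\mathrm{Rot}_G(u,i)=(v,j)\}|$. The second largest eigenvalue in absolute value is $\lambda(G)=\max_{\alpha\perp 1_N,\,\alpha\ne0}\|M\alpha\|/\|\alpha\|$, where $1_N$ is the all-ones vector and the norm is Euclidean (with $\lambda(G)=0$ if $N=1$). An $(N,D,\lambda)$-graph is a $D$-regular graph on $N$ vertices with $\lambda(G)\le\lambda$. Replacement product: for a $D_1$-regular graph $G_1$ on $[N_1]$ and a $D_2$-regular graph $G_2$ on $[D_1]$, it is the $(D_2+1)$-regular graph on $[N_1]\times[D_1]$ whose rotation map on input $((v,k),i)$ is: if $i\le D_2$, let $(m,j)=\mathrm{Rot}_{G_2}(k,i)$ and output $((v,m),j)$; if $i=D_2+1$, output $(\mathrm{Rot}_{G_1}(v,k),i)$. Computation: $\mathrm{poly}(\cdot)$ denotes a fixed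 unspecified polynomial in its arguments. An algorithm with oracle access to a function may evaluate it on inputs of its choice at the cost of one time step per evaluation. One single algorithm, given the parameters as additional input, works for all graphs; the time and query counts are per evaluation of the rotation map. *)

theory Defs
  imports "HOL-Analysis.Analysis"
begin

section \<open>Regular graphs given by rotation maps\<close>

text \<open>The edges at each vertex carry the labels \<open>{1..deg G}\<close>. The value of \<open>rot G\<close> outside
  \<open>verts G \<times> {1..deg G}\<close> is irrelevant.\<close>

record 'v rgraph =
  verts :: "'v set"
  deg :: nat
  rot :: "'v \<times> nat \<Rightarrow> 'v \<times> nat"

definition regular_graph :: "'v rgraph \<Rightarrow> bool" where
  "regular_graph G \<longleftrightarrow>
     finite (verts G) \<and> verts G \<noteq> {} \<and> deg G \<ge> 1 \<and>
     (\<forall>x \<in> verts G \<times> {1..deg G}.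
        rot G x \<in> verts G \<times> {1..deg G} \<and> rot G (rot G x) = x)"

definition adj :: "'v rgraph \<Rightarrow> 'v \<Rightarrow> 'v \<Rightarrow> real" where
  "adj G u v =
     real (card {(i, j). i \<in> {1..deg G} \<and> j \<in> {1..deg G} \<and> rot G (u, i) = (v, j)})
       / real (deg G)"

definition adj_mult :: "'v rgraph \<Rightarrow> ('v \<Rightarrow> real) \<Rightarrow> 'v \<Rightarrow> real" where
  "adj_mult G \<alpha> u = (\<Sum>v \<in> verts G. adj G u v * \<alpha> v)"

text \<open>Vectors are functions of which only the values on \<open>verts G\<close> matter. The supremum is the
  maximum of the quotient: by homogeneity it may be taken over the unit sphere of the orthogonal
  complement of the all-ones vector, which is compact.\<close>

definition second_eigenvalue :: "'v rgraph \<Rightarrow> real" where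
  "second_eigenvalue G =
     (if card (verts G) = 1 then 0
      else Sup {L2_set (adj_mult G \<alpha>) (verts G) / L2_set \<alpha> (verts G) | \<alpha>.
                  (\<Sum>v \<in> verts G. \<alpha> v) = 0 \<and> (\<exists>v \<in> verts G. \<alpha> v \<noteq> 0)})"

definition NDl_graph :: "nat \<Rightarrow> nat \<Rightarrow> real \<Rightarrow> 'v rgraph \<Rightarrow> bool" where
  "NDl_graph N D l G \<longleftrightarrow>
     regular_graph G \<and> card (verts G) = N \<and> deg G = D \<and> second_eigenvalue G \<le> l"

text \<open>Meaningful only if \<open>verts G2 = {1..deg G1}\<close>.\<close>

definition replacement_product :: "'v rgraph \<Rightarrow> nat rgraph \<Rightarrow> ('v \<times> nat) rgraph" where
  "replacement_product G1 G2 =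
     \<lparr> verts = verts G1 \<times> {1..deg G1},
       deg = deg G2 + 1,
       rot = (\<lambda>((v, k), i).
          if i \<le> deg G2 then (let (m, j) = rot G2 (k, i) in ((v, m), j))
          else (rot G1 (v, k), i)) \<rparr>"

definition f_bound :: "real \<Rightarrow> real \<Rightarrow> real" where
  "f_bound l1 l2 =
     1/2 * (1 - l2^2) * l1 + 1/2 * sqrt ((1 - l2^2)^2 * l1^2 + 4 * l2^2)"


section \<open>Algorithms with two oracles\<close>

text \<open>The machine model is a multi-stack machine: every register (indexed by a natural number, of
  which a program mentions only finitely many) holds a stack of bits, and every elementary
  instruction pushes, pops or inspects a single bit at unit cost. Two stacks simulate a tape and
  conversely, so up to constant factors this is the running time of multi-tape Turing machines.

  \<open>Query c r1 r2\<close> evaluates oracle \<open>c\<close> at the pair of numbers whose binary digits are in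
  registers \<open>r1\<close> and \<open>r2\<close>, and overwrites these registers with the two components of the answer;
  this is one time step. \<open>Branch r P0 P1 P2\<close> runs \<open>P0\<close> if register \<open>r\<close> is empty, and otherwise
  \<open>P1\<close> or \<open>P2\<close> according to whether its top bit is 0 or 1. \<open>While r P\<close> repeats \<open>P\<close> as long as
  register \<open>r\<close> is nonempty.\<close>

datatype oracle_name = Rot1 | Rot2

datatype program =
    Push nat bool
  | Pop nat
  | Query oracle_name nat nat
  | Then program program
  | Branch nat program program program
  | While nat program

type_synonym store = "nat \<Rightarrow> bool list"

text \<open>Binary representation, least significant bit first (on top of the stack) and without
  superfluous zeros.\<close>

fun bin :: "nat \<Rightarrow> bool list" where
  "bin n = (if n = 0 then [] else odd n # bin (n div 2))"

declare bin.simps [simp del]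

abbreviation bin_val :: "bool list \<Rightarrow> nat" where
  "bin_val bs \<equiv> horner_sum of_bool 2 bs"

text \<open>\<open>exec \<Omega> P s t q s'\<close>: with oracles \<open>\<Omega>\<close>, started on store \<open>s\<close>, program \<open>P\<close> halts after \<open>t\<close>
  time steps, having made \<open>q\<close> oracle queries in total, with store \<open>s'\<close>.\<close>

inductive exec ::
  "(oracle_name \<Rightarrow> nat \<times> nat \<Rightarrow> nat \<times> nat) \<Rightarrow> program \<Rightarrow> store \<Rightarrow> nat \<Rightarrow> nat \<Rightarrow> store \<Rightarrow> bool"
  for \<Omega> where
  Push: "exec \<Omega> (Push r b) s 1 0 (s(r := b # s r))"
| Pop: "exec \<Omega> (Pop r) s 1 0 (s(r := tl (s r)))"
| Query: "\<Omega> c (bin_val (s r1), bin_val (s r2)) = (x, y) \<Longrightarrow>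
    exec \<Omega> (Query c r1 r2) s 1 1 (s(r1 := bin x, r2 := bin y))"
| Then: "exec \<Omega> P s t q s' \<Longrightarrow> exec \<Omega> Q s' t' q' s'' \<Longrightarrow>
    exec \<Omega> (Then P Q) s (t + t') (q + q') s''"
| Branch: "exec \<Omega> (case s r of [] \<Rightarrow> P0 | b # _ \<Rightarrow> if b then P2 else P1) s t q s' \<Longrightarrow>
    exec \<Omega> (Branch r P0 P1 P2) s (t + 1) q s'"
| While_stop: "s r = [] \<Longrightarrow> exec \<Omega> (While r P) s 1 0 s"
| While_step: "s r \<noteq> [] \<Longrightarrow> exec \<Omega> P s t q s' \<Longrightarrow> exec \<Omega> (While r P) s' t' q' s'' \<Longrightarrow>
    exec \<Omega> (While r P) s (t + t' + 1) (q + q') s''"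

lemma exec_deterministic:
  "exec \<Omega> P s t q s' \<Longrightarrow> exec \<Omega> P s u r s'' \<Longrightarrow> t = u \<and> q = r \<and> s' = s''"
proof (induction arbitrary: u r s'' rule: exec.induct)
  case (Push x b s)
  from Push.prems show ?case by cases simp
next
  case (Pop x s)
  from Pop.prems show ?case by cases simp
next
  case (Query c s r1 r2 x y)
  from Query.prems show ?case by cases (use Query.hyps in simp)
next
  case (Then P s t q s' Q t' q' s'')
  from Then.prems show ?case by cases (metis Then.IH)
next
  case (Branch s x P0 P2 P1 t q s')
  from Branch.prems show ?case by cases (metis Branch.IH)
next
  case (While_stop s x P)
  from While_stop.prems show ?case by cases (use While_stop.hyps in simp_all)
next
  case (While_step s x P t q s' t' q' s'')
  from While_step.prems show ?case
  proof cases
    case While_stop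
    with While_step.hyps show ?thesis by simp
  next
    case While_step
    then show ?thesis by (metis While_step.IH)
  qed
qed

text \<open>Input and output numbers are stored, in order, in the registers \<open>0, 1, \<dots>\<close>; all other
  registers are initially empty, and arbitrary at the end.\<close>

definition load :: "nat list \<Rightarrow> store" where
  "load xs = (\<lambda>r. if r < length xs then bin (xs ! r) else [])"

definition computes ::
  "(oracle_name \<Rightarrow> nat \<times> nat \<Rightarrow> nat \<times> nat) \<Rightarrow> program \<Rightarrow> nat list \<Rightarrow> nat list \<Rightarrow> nat \<Rightarrow> nat \<Rightarrow> bool"
  where
  "computes \<Omega> P xs ys t q \<longleftrightarrow>
     (\<exists>s. exec \<Omega> P (load xs) t q s \<and> (\<forall>r < length ys. s r = bin (ys ! r)))"

fun rot_oracles :: "nat rgraph \<Rightarrow> nat rgraph \<Rightarrow> oracle_name \<Rightarrow> nat \<times> nat \<Rightarrow> nat \<times> nat" where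
  "rot_oracles G1 G2 Rot1 = rot G1"
| "rot_oracles G1 G2 Rot2 = rot G2"

definition polynomial3 :: "(real \<Rightarrow> real \<Rightarrow> real \<Rightarrow> real) \<Rightarrow> bool" where
  "polynomial3 F \<longleftrightarrow>
     (\<exists>d c. \<forall>x y z. F x y z = (\<Sum>i\<le>d. \<Sum>j\<le>d. \<Sum>k\<le>d. c i j k * x ^ i * y ^ j * z ^ k))"

end

theory Submission
  imports Defs
begin

text \<open>Write \<open>M = (D B + A) / (D + 1)\<close> with \<open>D = D2\<close>, where \<open>A\<close> permutes the coordinates by \<open>Rot_G1\<close> and
  \<open>B\<close> applies the normalized adjacency matrix of \<open>G2\<close> in every cloud. All words in the contractions
  \<open>A\<close>, \<open>B\<close> in the expansion of \<open>M\<^sup>3\<close> have norm at most 1, and \<open>B A B\<close>, which occurs with weight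
  \<open>p\<close>, is the zig-zag product, with norm at most \<open>f(\<lambda>1, \<lambda>2)\<close> on the complement of the constants.
  As \<open>M\<close> is symmetric, \<open>\<parallel>M x\<parallel>\<^sup>3 \<le> \<parallel>M\<^sup>3 x\<parallel> \<parallel>x\<parallel>\<^sup>2\<close> without recourse to eigenvectors.

  For the bound on \<open>B A B\<close>, let \<open>z\<close> be the projection of \<open>y = B x\<close> to the vectors constant on clouds.
  Since \<open>A\<^sup>2 = 1\<close> and \<open>f\<^sup>2 = (1 - \<lambda>2\<^sup>2) \<lambda>1 f + \<lambda>2\<^sup>2\<close>, the positive operator \<open>f - \<lambda>2\<^sup>2 A\<close> has an
  explicit inverse, and Cauchy-Schwarz for the form it defines bounds \<open>\<langle>A y, y\<rangle>\<close>.

  The algorithm decides \<open>i \<le> D2\<close> by one pass over the binary digits, and then makes its only query.\<close>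

section \<open>The algorithm\<close>

lemma bin_simps: "bin 0 = []" "n > 0 \<Longrightarrow> bin n = odd n # bin (n div 2)"
  by (subst bin.simps, simp)+

lemma bin_val_bin [simp]: "bin_val (bin n) = n"
proof (induction n rule: less_induct)
  case (less n)
  show ?case
  proof (cases "n = 0")
    case False
    with less[of "n div 2"] show ?thesis by (simp add: bin_simps(2))
  qed (simp add: bin_simps(1))
qed

lemma two_power_le_if_length_bin:
  assumes "m < length (bin n)"
  shows "2 ^ m \<le> n"
  using assms
proof (induction m arbitrary: n)
  case 0
  then show ?case by (cases "n = 0") (auto simp: bin_simps)
next
  case (Suc m)
  then have "n \<noteq> 0" by (auto simp: bin_simps(1) intro: ccontr)
  then have "n > 0" by simp
  with Suc.prems have "2 ^ m \<le> n div 2"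
    by (intro Suc.IH) (simp add: bin_simps(2))
  then show ?case by simp
qed

lemma bin_val_less: "bin_val bs < 2 ^ length bs"
  by (induction bs) auto

lemma length_bin_mono:
  assumes "m \<le> n"
  shows "length (bin m) \<le> length (bin n)"
proof (rule ccontr)
  assume "\<not> ?thesis"
  then have "2 ^ length (bin n) \<le> m" by (intro two_power_le_if_length_bin) simp
  with bin_val_less[of "bin n"] assms show False by simp
qed

lemma length_bin_Suc: "length (bin (Suc n)) \<le> Suc (length (bin n))"
proof (rule ccontr)
  assume "\<not> ?thesis"
  then have "2 ^ Suc (length (bin n)) \<le> Suc n" by (intro two_power_le_if_length_bin) simp
  with bin_val_less[of "bin n"] show False by simp
qed

lemma length_bin_le_log:
  assumes "n > 0"
  shows "real (length (bin n)) \<le> log 2 (real n) + 1"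
proof -
  have "length (bin n) > 0" using assms by (simp add: bin_simps)
  then have "2 ^ (length (bin n) - 1) \<le> n" by (intro two_power_le_if_length_bin) simp
  then have "real (length (bin n) - 1) \<le> log 2 (real n)" by (rule le_log2_of_power)
  then show ?thesis by simp
qed

section \<open>Stack subroutines and bounds for their running times\<close>

definition clear :: "nat \<Rightarrow> program" where
  "clear r = While r (Pop r)"

text \<open>\<open>Push\<close> carries a fixed bit, so copying a bit takes one branch per value.
  The bits arrive in reversed order; \<open>move\<close> restores the order by a second pass, out of
  the scratch register \<open>c\<close>.\<close>

definition shift :: "nat \<Rightarrow> nat \<Rightarrow> program" where
  "shift a b = While a (Branch a (Pop a) (Then (Push b False) (Pop a)) (Then (Push b True) (Pop a)))"

definition move :: "nat \<Rightarrow> nat \<Rightarrow> nat \<Rightarrow> program" where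
  "move c a b = Then (shift a c) (shift c b)"

text \<open>The loop is driven by \<open>a\<close> alone. An exhausted \<open>b\<close> reads as the
  digit 0, and digits of \<open>b\<close> beyond the length of \<open>a\<close> stay in place for a
  later test. The flag in \<open>d\<close> is replaced only when the digits differ; popping before
  pushing keeps it at most one bit long.\<close>

definition compare :: "nat \<Rightarrow> nat \<Rightarrow> nat \<Rightarrow> nat \<Rightarrow> program" where
  "compare a b c d = While a
     (Branch a (Pop a)
       (Then (Then (Push c False) (Pop a)) (Branch b (Pop b) (Pop b) (Then (Pop b) (Pop d))))
       (Then (Then (Push c True) (Pop a))
         (Branch b (Then (Pop b) (Then (Pop d) (Push d True)))
            (Then (Pop b) (Then (Pop d) (Push d True))) (Pop b))))"

text \<open>Time is bounded rather than exact, so that branches of different cost share one bound;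
  the number of queries stays exact.\<close>

definition runs ::
  "(oracle_name \<Rightarrow> nat \<times> nat \<Rightarrow> nat \<times> nat) \<Rightarrow> program \<Rightarrow> store \<Rightarrow> nat \<Rightarrow> nat \<Rightarrow> store \<Rightarrow> bool" where
  "runs \<Omega> P s T q s' \<longleftrightarrow> (\<exists>t\<le>T. exec \<Omega> P s t q s')"

lemma runs_mono: "runs \<Omega> P s T q s' \<Longrightarrow> T \<le> T' \<Longrightarrow> runs \<Omega> P s T' q s'"
  unfolding runs_def using order_trans by blast

lemma runs_Push: "runs \<Omega> (Push r b) s 1 0 (s(r := b # s r))"
  and runs_Pop: "runs \<Omega> (Pop r) s 1 0 (s(r := tl (s r)))"
  unfolding runs_def by (blast intro: exec.Push exec.Pop)+

lemma runs_Query: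
  "\<Omega> c (bin_val (s r1), bin_val (s r2)) = (x, y) \<Longrightarrow>
    runs \<Omega> (Query c r1 r2) s 1 1 (s(r1 := bin x, r2 := bin y))"
  unfolding runs_def by (blast intro: exec.Query)

lemma runs_Then:
  assumes "runs \<Omega> P s T q s'" "runs \<Omega> Q s' T' q' s''"
  shows "runs \<Omega> (Then P Q) s (T + T') (q + q') s''"
  using assms unfolding runs_def by (meson add_mono exec.Then)

lemma runs_Branch:
  assumes "runs \<Omega> (case s r of [] \<Rightarrow> P0 | b # _ \<Rightarrow> if b then P2 else P1) s T q s'"
  shows "runs \<Omega> (Branch r P0 P1 P2) s (T + 1) q s'"
proof -
  from assms obtain t where "t \<le> T" "exec \<Omega> (case s r of [] \<Rightarrow> P0 | b # _ \<Rightarrow> if b then P2 else P1) s t q s'"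
    by (auto simp: runs_def)
  then show ?thesis unfolding runs_def by (intro exI[of _ "t + 1"]) (simp add: exec.Branch[simplified])
qed

lemma runs_While_stop: "s r = [] \<Longrightarrow> runs \<Omega> (While r P) s 1 0 s"
  unfolding runs_def by (blast intro: exec.While_stop)

lemma runs_While_step:
  assumes "s r \<noteq> []" "runs \<Omega> P s T q s'" "runs \<Omega> (While r P) s' T' q' s''"
  shows "runs \<Omega> (While r P) s (T + T' + 1) (q + q') s''"
  using assms unfolding runs_def by (meson add_mono add_right_mono exec.While_step)

lemma runs_clear: "runs \<Omega> (clear r) s (2 * length (s r) + 1) 0 (s(r := []))"
proof (induction "s r" arbitrary: s)
  case Nil
  then have "s(r := []) = s" by (simp add: fun_upd_idem)
  with Nil show ?case using runs_While_stop[where s = s and r = r] by (simp add: clear_def)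
next
  case (Cons b bs)
  have "runs \<Omega> (clear r) (s(r := tl (s r))) (2 * length bs + 1) 0 (s(r := []))"
    using Cons(1)[of "s(r := tl (s r))"] by (simp flip: Cons(2))
  from runs_While_step[OF _ runs_Pop this[unfolded clear_def]]
  show ?case unfolding clear_def by (simp flip: Cons(2))
qed

text \<open>Every bit costs four steps (loop test, branch, push, pop), and the final loop test one
  more.\<close>

lemma runs_shift:
  assumes "a \<noteq> b"
  shows "runs \<Omega> (shift a b) s (4 * length (s a) + 1) 0 (s(a := [], b := rev (s a) @ s b))"
proof (induction "s a" arbitrary: s)
  case Nil
  then have "s(a := [], b := rev (s a) @ s b) = s" by (auto simp: fun_eq_iff)
  with Nil show ?case using runs_While_stop[where s = s and r = a] by (simp add: shift_def del: fun_upd_apply)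
next
  case (Cons x xs)
  define s' where "s' = s(b := x # s b, a := xs)"
  have pop: "runs \<Omega> (Then (Push b x) (Pop a)) s 2 0 s'"
    using runs_Then[OF runs_Push[of \<Omega> b x s] runs_Pop[where r = a]] assms
    by (simp add: s'_def eval_nat_numeral flip: Cons(2))
  have body: "runs \<Omega> (Branch a (Pop a) (Then (Push b False) (Pop a)) (Then (Push b True) (Pop a)))
      s (2 + 1) 0 s'"
    by (rule runs_Branch) (use pop in \<open>cases x; simp flip: Cons(2)\<close>)
  have upd: "s'(a := [], b := rev (s' a) @ s' b) = s(a := [], b := rev (s a) @ s b)"
    using assms by (auto simp: s'_def fun_eq_iff simp flip: Cons(2))
  have "runs \<Omega> (shift a b) s' (4 * length xs + 1) 0 (s(a := [], b := rev (s a) @ s b))"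
    using Cons(1)[of s'] upd by (simp add: s'_def)
  from runs_While_step[OF _ body this[unfolded shift_def]]
  show ?case unfolding shift_def by (simp flip: Cons(2))
qed

lemma runs_move:
  assumes "distinct [a, b, c]" "s c = []" "s b = []"
  shows "runs \<Omega> (move c a b) s (8 * length (s a) + 2) 0 (s(a := [], b := s a))"
proof -
  have "runs \<Omega> (move c a b) s ((4 * length (s a) + 1) + (4 * length (s a) + 1)) (0 + 0)
      (s(a := [], b := s a))"
    unfolding move_def
  proof (rule runs_Then)
    show "runs \<Omega> (shift a c) s (4 * length (s a) + 1) 0 (s(a := [], c := rev (s a)))"
      using runs_shift[of a c \<Omega> s] assms by simp
    have "s(a := [], c := [], b := s a) = s(a := [], b := s a)"
      using assms by (auto simp: fun_eq_iff)
    then show "runs \<Omega> (shift c b) (s(a := [], c := rev (s a))) (4 * length (s a) + 1) 0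
        (s(a := [], b := s a))"
      using runs_shift[of c b \<Omega> "s(a := [], c := rev (s a))"] assms by simp
  qed
  then show ?thesis by simp
qed

text \<open>The flag register \<open>d\<close> records whether the digits of \<open>a\<close> read so far form a larger number than
  those of \<open>b\<close>; a differing digit overrides all less significant ones. The digits of \<open>a\<close> are kept,
  reversed, in \<open>c\<close>.\<close>

lemma runs_compare:
  fixes flag :: bool
  assumes "distinct [a, b, c, d]" "s d = (if flag then [True] else [])"
  shows "runs \<Omega> (compare a b c d) s (8 * length (s a) + 1) 0
    (s(a := [], b := drop (length (s a)) (s b), c := rev (s a) @ s c,
       d := if bin_val (s a) > bin_val (take (length (s a)) (s b)) \<or>
               bin_val (s a) = bin_val (take (length (s a)) (s b)) \<and> flag
            then [True] else []))"
  using assms(2)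
proof (induction "s a" arbitrary: s flag)
  case Nil
  then have "s(a := [], b := drop (length (s a)) (s b), c := rev (s a) @ s c,
     d := if bin_val (s a) > bin_val (take (length (s a)) (s b)) \<or>
             bin_val (s a) = bin_val (take (length (s a)) (s b)) \<and> flag
          then [True] else []) = s"
    using assms(1) by (auto simp: fun_eq_iff)
  with Nil show ?case using runs_While_stop[where s = s and r = a] by (simp only: compare_def) simp
next
  case (Cons x xs)
  \<comment> \<open>The digit of \<open>b\<close> at the current position, 0 if \<open>b\<close> is
    exhausted.\<close>
  define y where "y = (s b \<noteq> [] \<and> hd (s b))"
  define flag' where "flag' = (if x = y then flag else x)"
  define s1 where "s1 = s(c := x # s c, a := xs)"
  define s' where "s' = s1(b := tl (s b), d := if flag' then [True] else [])"
  have s1: "s1 b = s b" "s1 d = s d" using assms(1) by (auto simp: s1_def)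
  note sa = Cons(2)[symmetric]
  have pop: "runs \<Omega> (Then (Push c x) (Pop a)) s (1 + 1) (0 + 0) s1"
    using runs_Then[OF runs_Push[of \<Omega> c x s] runs_Pop[where r = a]] assms(1)
    by (simp add: s1_def sa)
  have popb: "runs \<Omega> (Pop b) s1 1 0 (s1(b := tl (s b)))"
    using runs_Pop[of \<Omega> b s1] by (simp add: s1)
  have sd: "s' = s1(b := tl (s b))" if "flag' = flag"
    using that Cons(3) assms(1) by (auto simp: s'_def fun_eq_iff s1)
  have b0: "runs \<Omega> (Branch b (Pop b) (Pop b) (Then (Pop b) (Pop d))) s1 (2 + 1) 0 s'" if "\<not> x"
  proof (rule runs_Branch)
    have 1: "runs \<Omega> (Pop b) s1 2 0 s'" if "\<not> y"
    proof -
      have "flag' = flag" using \<open>\<not> x\<close> that by (simp add: flag'_def)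
      from popb[folded sd[OF this]] show ?thesis by (rule runs_mono) simp
    qed
    have 2: "runs \<Omega> (Then (Pop b) (Pop d)) s1 2 0 s'" if "y"
    proof -
      have "(s1(b := tl (s b)))(d := tl ((s1(b := tl (s b))) d)) = s'"
        using \<open>\<not> x\<close> that assms(1) Cons(3) by (auto simp: s'_def flag'_def s1 fun_eq_iff)
      with runs_Then[OF popb runs_Pop[where r = d]] show ?thesis by (simp add: eval_nat_numeral)
    qed
    show "runs \<Omega> (case s1 b of [] \<Rightarrow> Pop b | z # _ \<Rightarrow> if z then Then (Pop b) (Pop d) else Pop b) s1 2 0 s'"
      using 1 2 by (cases "s b") (auto simp: s1 y_def)
  qed
  let ?G = "Then (Pop b) (Then (Pop d) (Push d True))"
  have b1: "runs \<Omega> (Branch b ?G ?G (Pop b)) s1 (3 + 1) 0 s'" if "x"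
  proof (rule runs_Branch)
    have 1: "runs \<Omega> (Pop b) s1 3 0 s'" if "y"
    proof -
      have "flag' = flag" using \<open>x\<close> that by (simp add: flag'_def)
      from popb[folded sd[OF this]] show ?thesis by (rule runs_mono) simp
    qed
    have 2: "runs \<Omega> ?G s1 3 0 s'" if "\<not> y"
    proof -
      have *: "s1(b := tl (s b), d := [True]) = s'"
        using \<open>x\<close> that by (auto simp: s'_def flag'_def)
      show ?thesis
        using runs_Then[OF popb runs_Then[OF runs_Pop[where r = d] runs_Push[where r = d and b = True]]] assms(1) Cons(3) *
        by (auto simp: s1 numeral_3_eq_3 split: if_splits)
    qed
    show "runs \<Omega> (case s1 b of [] \<Rightarrow> ?G | z # _ \<Rightarrow> if z then Pop b else ?G) s1 3 0 s'"
      using 1 2 by (cases "s b") (auto simp: s1 y_def)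
  qed
  have body: "runs \<Omega> (Branch a (Pop a)
       (Then (Then (Push c False) (Pop a)) (Branch b (Pop b) (Pop b) (Then (Pop b) (Pop d))))
       (Then (Then (Push c True) (Pop a)) (Branch b ?G ?G (Pop b)))) s (6 + 1) 0 s'"
  proof (rule runs_Branch, cases x)
    case True
    then show "runs \<Omega> (case s a of [] \<Rightarrow> Pop a | z # _ \<Rightarrow> if z then
         Then (Then (Push c True) (Pop a)) (Branch b ?G ?G (Pop b)) else
         Then (Then (Push c False) (Pop a)) (Branch b (Pop b) (Pop b) (Then (Pop b) (Pop d)))) s 6 0 s'"
      using runs_Then[OF pop b1] by (simp add: sa)
  next
    case False
    then show "runs \<Omega> (case s a of [] \<Rightarrow> Pop a | z # _ \<Rightarrow> if z then
         Then (Then (Push c True) (Pop a)) (Branch b ?G ?G (Pop b)) else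
         Then (Then (Push c False) (Pop a)) (Branch b (Pop b) (Pop b) (Then (Pop b) (Pop d)))) s 6 0 s'"
      using runs_mono[OF runs_Then[OF pop b0]] by (simp add: sa)
  qed
  have s': "s' a = xs" "s' b = tl (s b)" "s' c = x # s c" "s' d = (if flag' then [True] else [])"
    using assms(1) by (auto simp: s'_def s1_def)
  have val: "bin_val (take (length (s a)) (s b)) = of_bool y + 2 * bin_val (take (length xs) (tl (s b)))"
    by (cases "s b") (auto simp: y_def sa)
  \<comment> \<open>Comparing x + 2 X with y + 2 Y: the higher digits X, Y decide, a tie passes to
    x, y, and a second tie to the old flag. The last two rules are merged in
    \<open>flag'\<close>.\<close>
  have flag: "(bin_val xs > bin_val (take (length xs) (tl (s b))) \<or>
         bin_val xs = bin_val (take (length xs) (tl (s b))) \<and> flag') \<longleftrightarrow>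
       (bin_val (s a) > bin_val (take (length (s a)) (s b)) \<or>
         bin_val (s a) = bin_val (take (length (s a)) (s b)) \<and> flag)"
    unfolding val unfolding sa flag'_def
    by (cases x; cases y) (auto simp: Suc_double_not_eq_double double_not_eq_Suc_double)
  have drop: "drop (length xs) (tl (s b)) = drop (length (s a)) (s b)"
    by (simp add: sa drop_Suc)
  have "runs \<Omega> (compare a b c d) s' (8 * length (s' a) + 1) 0
    (s'(a := [], b := drop (length (s' a)) (s' b), c := rev (s' a) @ s' c,
       d := if bin_val (s' a) > bin_val (take (length (s' a)) (s' b)) \<or>
               bin_val (s' a) = bin_val (take (length (s' a)) (s' b)) \<and> flag'
            then [True] else []))"
    using Cons(1)[of s' flag'] s' by auto
  also have "s'(a := [], b := drop (length (s' a)) (s' b), c := rev (s' a) @ s' c,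
       d := if bin_val (s' a) > bin_val (take (length (s' a)) (s' b)) \<or>
               bin_val (s' a) = bin_val (take (length (s' a)) (s' b)) \<and> flag'
            then [True] else []) =
     s(a := [], b := drop (length (s a)) (s b), c := rev (s a) @ s c,
       d := if bin_val (s a) > bin_val (take (length (s a)) (s b)) \<or>
               bin_val (s a) = bin_val (take (length (s a)) (s b)) \<and> flag
            then [True] else [])"
    unfolding s' flag drop by (auto simp: fun_eq_iff sa s'_def s1_def)
  finally have "runs \<Omega> (compare a b c d) s' (8 * length xs + 1) 0 \<dots>" unfolding s'(1) .
  from runs_While_step[OF _ body this[unfolded compare_def]]
  show ?case unfolding compare_def sa[symmetric] by (simp flip: Cons(2) del: fun_upd_apply)
qed

text \<open>Digits of \<open>m\<close> beyond the length n of \<open>i\<close> force 2^n <= m, while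
  i < 2^n; if there are none, \<open>take\<close> returns all of \<open>m\<close>. Thus emptiness of
  the rest and the flag together decide which rotation map to query.\<close>

lemma bin_compare:
  assumes "n = length (bin i)"
  shows "drop n (bin m) = [] \<and> bin_val (bin i) > bin_val (take n (bin m)) \<longleftrightarrow> m < i"
proof (cases "length (bin m) \<le> n")
  case False
  then have "2 ^ n \<le> m" by (intro two_power_le_if_length_bin) simp
  with bin_val_less[of "bin i"] assms have "i < m" by simp
  with False show ?thesis by simp
qed simp

text \<open>Registers 0 to 5 receive N1, D1, D2, v, k, i; 6 is scratch and 7 the flag. After the
  comparison register 2 holds the digits of D2 beyond the length of i: \<open>Rot1\<close> is
  queried only if it is empty and the flag is set. Each run passes through exactly one
  \<open>Query\<close>. Registers 0, 1, 2 are emptied because they receive the output.\<close>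

definition replacement_program :: program where
  "replacement_program =
     Then (clear 0) (Then (clear 1) (Then (compare 5 2 6 7) (Then (shift 6 5)
       (Then (Branch 2 (Branch 7 (Query Rot2 4 5) (Query Rot2 4 5) (Query Rot1 3 4))
                (Query Rot2 4 5) (Query Rot2 4 5))
         (Then (clear 2) (Then (move 6 3 0) (Then (move 6 4 1) (move 6 5 2))))))))"

lemma replacement_program_correct:
  assumes G1: "regular_graph G1" "verts G1 = {1..N1}" "deg G1 = D1"
    and G2: "regular_graph G2" "verts G2 = {1..D1}" "deg G2 = D2"
    and v: "v \<in> {1..N1}" and k: "k \<in> {1..D1}" and i: "i \<in> {1..D2 + 1}"
    and rot: "rot (replacement_product G1 G2) ((v, k), i) = ((w, m), j)"
  shows "\<exists>t. computes (rot_oracles G1 G2) replacement_program [N1, D1, D2, v, k, i] [w, m, j] t 1 \<and>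
           t \<le> 40 * (length (bin N1) + length (bin D1) + length (bin D2)) + 40"
proof -
  let ?\<Omega> = "rot_oracles G1 G2" and ?l = "\<lambda>n. length (bin n)"
  let ?s0 = "load [N1, D1, D2, v, k, i]"
  define r where "r = drop (?l i) (bin D2)"
  define fl where "fl = (if bin_val (bin i) > bin_val (take (?l i) (bin D2)) then [True] else [])"
  have s0: "?s0 = (\<lambda>_. [])(0 := bin N1, 1 := bin D1, 2 := bin D2, 3 := bin v, 4 := bin k, 5 := bin i)"
    by (auto simp: load_def fun_eq_iff nth_Cons numeral_eq_Suc split: nat.splits)
  \<comment> \<open>Stores after the initial clearing (\<open>s2\<close>), before the query
    (\<open>s4\<close>), after it (\<open>s5\<close>) and at the end (\<open>s9\<close>). One
    \<open>s5\<close> serves both queries: \<open>Rot2\<close> leaves v = w in register 3, and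
    \<open>Rot1\<close> leaves i = j in register 5.\<close>
  define s2 :: store where "s2 = (\<lambda>_. [])(2 := bin D2, 3 := bin v, 4 := bin k, 5 := bin i)"
  define s4 :: store where "s4 = (\<lambda>_. [])(2 := r, 3 := bin v, 4 := bin k, 5 := bin i, 7 := fl)"
  define s5 :: store where "s5 = (\<lambda>_. [])(2 := r, 3 := bin w, 4 := bin m, 5 := bin j, 7 := fl)"
  define s9 :: store where "s9 = (\<lambda>_. [])(0 := bin w, 1 := bin m, 2 := bin j, 7 := fl)"
  have c0: "runs ?\<Omega> (clear 0) ?s0 (2 * ?l N1 + 1) 0 (?s0(0 := []))"
    using runs_clear[of ?\<Omega> 0 ?s0] by (simp add: s0)
  have c1: "runs ?\<Omega> (clear 1) (?s0(0 := [])) (2 * ?l D1 + 1) 0 s2"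
  proof -
    have "?s0(0 := [], 1 := []) = s2" by (auto simp: s0 s2_def fun_eq_iff)
    with runs_clear[of ?\<Omega> 1 "?s0(0 := [])"] show ?thesis by (simp add: s0)
  qed
  have c2: "runs ?\<Omega> (compare 5 2 6 7) s2 (8 * ?l i + 1) 0 (s4(5 := [], 6 := rev (bin i)))"
  proof -
    have "runs ?\<Omega> (compare 5 2 6 7) s2 (8 * ?l i + 1) 0
       (s2(5 := [], 2 := r, 6 := rev (bin i), 7 := fl))"
      using runs_compare[of 5 2 6 7 s2 False ?\<Omega>] by (simp add: s2_def r_def fl_def)
    also have "s2(5 := [], 2 := r, 6 := rev (bin i), 7 := fl) = s4(5 := [], 6 := rev (bin i))"
      by (auto simp: s2_def s4_def fun_eq_iff)
    finally show ?thesis .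
  qed
  have c3: "runs ?\<Omega> (shift 6 5) (s4(5 := [], 6 := rev (bin i))) (4 * ?l i + 1) 0 s4"
  proof -
    have "s4(5 := [], 6 := [], 5 := bin i) = s4" by (auto simp: s4_def fun_eq_iff)
    with runs_shift[of 6 5 ?\<Omega> "s4(5 := [], 6 := rev (bin i))"] show ?thesis by simp
  qed
  have q2: "runs ?\<Omega> (Query Rot2 4 5) s4 1 1 s5" if "i \<le> D2"
  proof -
    from rot that have "w = v" "rot G2 (k, i) = (m, j)"
      by (auto simp: replacement_product_def G2 split: prod.splits)
    moreover have "s4(4 := bin m, 5 := bin j) = s5" if "w = v"
      using that by (auto simp: s4_def s5_def fun_eq_iff)
    ultimately show ?thesis
      using runs_Query[of ?\<Omega> Rot2 s4 4 5 m j] by (simp add: s4_def)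
  qed
  have q1: "runs ?\<Omega> (Query Rot1 3 4) s4 1 1 s5" if "\<not> i \<le> D2"
  proof -
    from rot that have "j = i" "rot G1 (v, k) = (w, m)"
      by (auto simp: replacement_product_def G2 split: prod.splits)
    moreover have "s4(3 := bin w, 4 := bin m) = s5" if "j = i"
      using that by (auto simp: s4_def s5_def fun_eq_iff)
    ultimately show ?thesis
      using runs_Query[of ?\<Omega> Rot1 s4 3 4 w m] by (simp add: s4_def)
  qed
  have c4: "runs ?\<Omega> (Branch 2 (Branch 7 (Query Rot2 4 5) (Query Rot2 4 5) (Query Rot1 3 4))
                (Query Rot2 4 5) (Query Rot2 4 5)) s4 (2 + 1) 1 s5"
  proof (rule runs_Branch, cases "r = []")
    case True
    have "fl = (if i \<le> D2 then [] else [True])"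
      using bin_compare[of "?l i" i D2] True by (auto simp: fl_def r_def)
    then have "runs ?\<Omega> (Branch 7 (Query Rot2 4 5) (Query Rot2 4 5) (Query Rot1 3 4)) s4 (1 + 1) 1 s5"
      by (intro runs_Branch) (use q1 q2 in \<open>auto simp: s4_def split: if_splits\<close>)
    with True show "runs ?\<Omega> (case s4 2 of [] \<Rightarrow> Branch 7 (Query Rot2 4 5) (Query Rot2 4 5) (Query Rot1 3 4)
       | b # _ \<Rightarrow> if b then Query Rot2 4 5 else Query Rot2 4 5) s4 2 1 s5"
      by (simp add: s4_def numeral_2_eq_2)
  next
    case False
    then have "i \<le> D2" using bin_compare[of "?l i" i D2] by (auto simp: r_def)
    from runs_mono[OF q2[OF this], of 2] False
    show "runs ?\<Omega> (case s4 2 of [] \<Rightarrow> Branch 7 (Query Rot2 4 5) (Query Rot2 4 5) (Query Rot1 3 4)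
       | b # _ \<Rightarrow> if b then Query Rot2 4 5 else Query Rot2 4 5) s4 2 1 s5"
      by (cases r) (auto simp: s4_def)
  qed
  have c5: "runs ?\<Omega> (clear 2) s5 (2 * length r + 1) 0 (s5(2 := []))"
    using runs_clear[of ?\<Omega> 2 s5] by (simp add: s5_def)
  have c6: "runs ?\<Omega> (move 6 3 0) (s5(2 := [])) (8 * ?l w + 2) 0 (s5(2 := [], 3 := [], 0 := bin w))"
    using runs_move[of 3 0 6 "s5(2 := [])" ?\<Omega>] by (simp add: s5_def)
  have c7: "runs ?\<Omega> (move 6 4 1) (s5(2 := [], 3 := [], 0 := bin w)) (8 * ?l m + 2) 0
      (s5(2 := [], 3 := [], 0 := bin w, 4 := [], 1 := bin m))"
    using runs_move[of 4 1 6 "s5(2 := [], 3 := [], 0 := bin w)" ?\<Omega>] by (simp add: s5_def)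
  have c8: "runs ?\<Omega> (move 6 5 2) (s5(2 := [], 3 := [], 0 := bin w, 4 := [], 1 := bin m))
      (8 * ?l j + 2) 0 s9"
  proof -
    have "s5(2 := [], 3 := [], 0 := bin w, 4 := [], 1 := bin m, 5 := [], 2 := bin j) = s9"
      by (auto simp: s5_def s9_def fun_eq_iff)
    with runs_move[of 5 2 6 "s5(2 := [], 3 := [], 0 := bin w, 4 := [], 1 := bin m)" ?\<Omega>]
    show ?thesis by (simp add: s5_def)
  qed
  let ?T = "(2 * ?l N1 + 1) + ((2 * ?l D1 + 1) + ((8 * ?l i + 1) + ((4 * ?l i + 1) + ((2 + 1) +
    ((2 * length r + 1) + ((8 * ?l w + 2) + ((8 * ?l m + 2) + (8 * ?l j + 2))))))))"
  have "runs ?\<Omega> replacement_program ?s0 ?T (0 + (0 + (0 + (0 + (1 + (0 + (0 + (0 + 0)))))))) s9"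
    unfolding replacement_program_def
    by (rule runs_Then c0 c1 c2 c3 c4 c5 c6 c7 c8)+
  then obtain t where t: "t \<le> ?T" "exec ?\<Omega> replacement_program ?s0 t 1 s9"
    by (auto simp: runs_def)
  \<comment> \<open>The answer lies in the ranges of the graphs, so the cost of moving it is bounded
    by the lengths of the parameters; the label D2 + 1 may be one digit longer than D2.\<close>
  have rng: "w \<in> {1..N1}" "m \<in> {1..D1}" "j \<in> {1..D2 + 1}"
  proof -
    have "w \<in> {1..N1} \<and> m \<in> {1..D1} \<and> j \<in> {1..D2 + 1}"
    proof (cases "i \<le> D2")
      case True
      with rot have "w = v" "rot G2 (k, i) = (m, j)"
        by (auto simp: replacement_product_def G2 split: prod.splits)
      moreover have "rot G2 (k, i) \<in> {1..D1} \<times> {1..D2}"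
        using G2 k i True by (auto simp: regular_graph_def)
      ultimately show ?thesis using v by auto
    next
      case False
      with rot have "j = i" "rot G1 (v, k) = (w, m)"
        by (auto simp: replacement_product_def G2 split: prod.splits)
      moreover have "rot G1 (v, k) \<in> {1..N1} \<times> {1..D1}"
        using G1 v k by (auto simp: regular_graph_def)
      ultimately show ?thesis using i by auto
    qed
    then show "w \<in> {1..N1}" "m \<in> {1..D1}" "j \<in> {1..D2 + 1}" by auto
  qed
  have "?l w \<le> ?l N1" "?l m \<le> ?l D1" "?l j \<le> ?l (Suc D2)" "?l i \<le> ?l (Suc D2)"
    using rng i by (auto intro!: length_bin_mono)
  moreover have "length r \<le> ?l D2" by (simp add: r_def)
  ultimately have "t \<le> 40 * (?l N1 + ?l D1 + ?l D2) + 40"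
    using t(1) length_bin_Suc[of D2] by simp
  moreover have "computes ?\<Omega> replacement_program [N1, D1, D2, v, k, i] [w, m, j] t 1"
    unfolding computes_def
    by (rule exI[of _ s9], intro conjI t(2))
      (auto simp: s9_def nth_Cons less_Suc_eq numeral_eq_Suc split: nat.splits)
  ultimately show ?thesis by blast
qed

lemma polynomial3_affine: "polynomial3 (\<lambda>x y z. a * (x + y + z) + b)"
  unfolding polynomial3_def
  by (intro exI[of _ 1] exI[of _ "\<lambda>i j k. if i + j + k = 0 then b else if i + j + k = 1 then a else 0"])
    (simp add: algebra_simps)

lemma replacement_program_polynomial:
  "\<exists>P F. polynomial3 F \<and>
      (\<forall>N1 D1 D2 (G1 :: nat rgraph) (G2 :: nat rgraph).
         regular_graph G1 \<and> verts G1 = {1..N1} \<and> deg G1 = D1 \<and>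
         regular_graph G2 \<and> verts G2 = {1..D1} \<and> deg G2 = D2 \<longrightarrow>
         (\<forall>v \<in> {1..N1}. \<forall>k \<in> {1..D1}. \<forall>i \<in> {1..D2 + 1}. \<forall>w m j.
            rot (replacement_product G1 G2) ((v, k), i) = ((w, m), j) \<longrightarrow>
            (\<exists>t. computes (rot_oracles G1 G2) P [N1, D1, D2, v, k, i] [w, m, j] t 1 \<and>
                 real t \<le> F (log 2 (real N1)) (log 2 (real D1)) (log 2 (real D2)))))"
\<comment> \<open>Each of the three lengths is at most its logarithm plus 1, whence 160 = 40 + 3 *
  40.\<close>
proof (intro exI[of _ replacement_program] exI[of _ "\<lambda>x y z. 40 * (x + y + z) + 160"]
    conjI polynomial3_affine allI ballI impI)
  fix N1 D1 D2 v k i w m j and G1 G2 :: "nat rgraph"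
  assume G: "regular_graph G1 \<and> verts G1 = {1..N1} \<and> deg G1 = D1 \<and>
         regular_graph G2 \<and> verts G2 = {1..D1} \<and> deg G2 = D2"
    and v: "v \<in> {1..N1}" and k: "k \<in> {1..D1}" and i: "i \<in> {1..D2 + 1}"
    and rot: "rot (replacement_product G1 G2) ((v, k), i) = ((w, m), j)"
  obtain t where t: "computes (rot_oracles G1 G2) replacement_program [N1, D1, D2, v, k, i] [w, m, j] t 1"
    "t \<le> 40 * (length (bin N1) + length (bin D1) + length (bin D2)) + 40"
    using replacement_program_correct[OF _ _ _ _ _ _ v k i rot] G by blast
  have pos: "N1 > 0" "D1 > 0" "D2 > 0" using G v k by (auto simp: regular_graph_def)
  have "real t \<le> 40 * (real (length (bin N1)) + real (length (bin D1)) + real (length (bin D2))) + 40"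
    using of_nat_mono[OF t(2), where 'a = real] by simp
  also have "\<dots> \<le> 40 * (log 2 (real N1) + log 2 (real D1) + log 2 (real D2)) + 160"
    using pos[THEN length_bin_le_log] by simp
  finally show "\<exists>t. computes (rot_oracles G1 G2) replacement_program [N1, D1, D2, v, k, i] [w, m, j] t 1 \<and>
      real t \<le> 40 * (log 2 (real N1) + log 2 (real D1) + log 2 (real D2)) + 160"
    using t(1) by blast
qed

section \<open>Norms of symmetric operators on finite-dimensional function spaces\<close>

definition ip :: "'a set \<Rightarrow> ('a \<Rightarrow> real) \<Rightarrow> ('a \<Rightarrow> real) \<Rightarrow> real" where
  "ip V x y = (\<Sum>v\<in>V. x v * y v)"

lemma ip_commute: "ip V x y = ip V y x"
  by (simp add: ip_def mult.commute)

lemma ip_add: "ip V (\<lambda>v. x v + y v) z = ip V x z + ip V y z" "ip V z (\<lambda>v. x v + y v) = ip V z x + ip V z y"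
  and ip_diff: "ip V (\<lambda>v. x v - y v) z = ip V x z - ip V y z" "ip V z (\<lambda>v. x v - y v) = ip V z x - ip V z y"
  and ip_scale: "ip V (\<lambda>v. c * x v) z = c * ip V x z" "ip V z (\<lambda>v. c * x v) = c * ip V z x"
  by (simp_all add: ip_def algebra_simps sum.distrib sum_subtractf sum_distrib_left)

lemmas ip_linear = ip_add ip_diff ip_scale

lemma ip_cong: "(\<And>v. v \<in> V \<Longrightarrow> x v = x' v) \<Longrightarrow> (\<And>v. v \<in> V \<Longrightarrow> y v = y' v) \<Longrightarrow> ip V x y = ip V x' y'"
  unfolding ip_def by (rule sum.cong) auto

lemma ip_nonneg: "0 \<le> ip V x x"
  by (simp add: ip_def sum_nonneg)

lemma L2_set_eq_sqrt_ip: "L2_set x V = sqrt (ip V x x)"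
  by (simp add: L2_set_def ip_def power2_eq_square)

lemma L2_set_power2: "(L2_set x V)\<^sup>2 = ip V x x"
  by (simp add: L2_set_eq_sqrt_ip ip_nonneg)

lemma ip_le_L2_set: "ip V x y \<le> L2_set x V * L2_set y V"
  unfolding ip_def
  by (rule order_trans[OF sum_mono L2_set_mult_ineq]) (simp add: abs_mult[symmetric])

lemma L2_set_scale: "c \<ge> 0 \<Longrightarrow> L2_set (\<lambda>v. c * x v) V = c * L2_set x V"
  by (simp add: L2_set_right_distrib)

text \<open>By polarization of \<open>\<langle>T (t x), T x\<rangle>\<close> with \<open>t = \<parallel>T x\<parallel> / \<parallel>x\<parallel>\<close>.\<close>

lemma symmetric_norm_le:
  fixes T :: "('a \<Rightarrow> real) \<Rightarrow> 'a \<Rightarrow> real"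
  assumes lin: "\<And>a b x y v. v \<in> V \<Longrightarrow> T (\<lambda>v. a * x v + b * y v) v = a * T x v + b * T y v"
    and sym: "\<And>x y. ip V (T x) y = ip V x (T y)"
    and sum0: "\<And>x. sum x V = 0 \<Longrightarrow> sum (T x) V = 0"
    and bound: "\<And>x. sum x V = 0 \<Longrightarrow> \<bar>ip V (T x) x\<bar> \<le> c * ip V x x"
    and c: "c \<ge> 0" and x: "sum x V = 0"
  shows "L2_set (T x) V \<le> c * L2_set x V"
proof -
  define y where "y = T x"
  define X where "X = L2_set x V"
  define Y where "Y = L2_set y V"
  have X0: "X \<ge> 0" by (simp add: X_def L2_set_nonneg)
  have key: "2 * t * Y\<^sup>2 \<le> c * (t\<^sup>2 * X\<^sup>2 + Y\<^sup>2)" for t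
  proof -
    let ?q = "\<lambda>e. ip V (T (\<lambda>v. t * x v + e * y v)) (\<lambda>v. t * x v + e * y v)"
    have q: "?q e = t\<^sup>2 * ip V y x + 2 * e * t * ip V y y + e\<^sup>2 * ip V (T y) y" for e
    proof -
      have "?q e = ip V (\<lambda>v. t * y v + e * T y v) (\<lambda>v. t * x v + e * y v)"
        by (rule ip_cong) (simp_all add: lin y_def)
      also have "\<dots> = t\<^sup>2 * ip V y x + e * t * ip V y y + e * t * ip V (T y) x + e\<^sup>2 * ip V (T y) y"
        by (simp add: ip_linear algebra_simps power2_eq_square)
      also have "ip V (T y) x = ip V y y" by (simp add: sym y_def)
      finally show ?thesis by simp
    qed
    have s: "\<bar>?q e\<bar> \<le> c * (t\<^sup>2 * X\<^sup>2 + 2 * e * t * ip V x y + e\<^sup>2 * Y\<^sup>2)" for e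
    proof -
      have "sum (\<lambda>v. t * x v + e * y v) V = 0"
        using x sum0[OF x] by (simp add: sum.distrib y_def flip: sum_distrib_left)
      from bound[OF this] have "\<bar>?q e\<bar> \<le> c * ip V (\<lambda>v. t * x v + e * y v) (\<lambda>v. t * x v + e * y v)" .
      also have "ip V (\<lambda>v. t * x v + e * y v) (\<lambda>v. t * x v + e * y v) =
          t\<^sup>2 * X\<^sup>2 + 2 * e * t * ip V x y + e\<^sup>2 * Y\<^sup>2"
        unfolding X_def Y_def L2_set_power2 ip_linear ip_commute[of V y x]
        by (simp add: algebra_simps power2_eq_square)
      finally show ?thesis .
    qed
    \<comment> \<open>Subtracting cancels the diagonal terms of the form, and adding the two bounds
      cancels the cross term <x, y>.\<close>
    have "4 * t * Y\<^sup>2 = ?q 1 - ?q (-1)"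
      unfolding q by (simp add: Y_def L2_set_power2)
    also have "\<dots> \<le> c * (t\<^sup>2 * X\<^sup>2 + 2 * t * ip V x y + Y\<^sup>2) + c * (t\<^sup>2 * X\<^sup>2 - 2 * t * ip V x y + Y\<^sup>2)"
      using s[of 1] s[of "-1"] by simp
    finally show ?thesis by (simp add: algebra_simps)
  qed
  have "Y \<le> c * X"
  proof (cases "X = 0 \<or> Y = 0")
    case True
    have "Y = 0"
    proof (rule ccontr)
      assume "Y \<noteq> 0"
      with True have "X = 0" by simp
      \<comment> \<open>With X = 0, \<open>key\<close> reads 2 t Y^2 <= c Y^2 for every t; the
        choice t = c + 1 contradicts Y being nonzero.\<close>
      with key[of "c + 1"] have "(c + 2) * Y\<^sup>2 \<le> 0" by (simp add: algebra_simps)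
      with \<open>Y \<noteq> 0\<close> c show False by (simp add: mult_le_0_iff)
    qed
    then show ?thesis using c X0 by simp
  next
    case False
    with X0 have X: "X > 0" by simp
    have "(Y / X)\<^sup>2 * X\<^sup>2 = Y\<^sup>2" using X by (simp add: power_divide)
    with key[of "Y / X"] have "(Y / X) * (2 * Y\<^sup>2) \<le> c * (2 * Y\<^sup>2)" by (simp add: mult_ac)
    with False have "Y / X \<le> c" by (simp only: mult_le_cancel_right) (simp add: zero_less_mult_iff not_less)
    with X show ?thesis by (simp add: field_simps)
  qed
  then show ?thesis by (simp add: X_def Y_def y_def)
qed

text \<open>Symmetry and Cauchy-Schwarz give |T y|^2 = <T T y, y> <= |T T y| |y|. Used for y = x and
  y = T x, this is log-convexity of the norms of the iterates.\<close>

lemma symmetric_norm_cube_le: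
  assumes sym: "\<And>x y. ip V (T x) y = ip V x (T y)"
  shows "L2_set (T x) V ^ 3 \<le> L2_set (T (T (T x))) V * L2_set x V ^ 2"
proof -
  let ?n = "\<lambda>x. L2_set x V"
  have nn: "0 \<le> ?n y" for y by (rule L2_set_nonneg)
  have step: "(?n (T y))\<^sup>2 \<le> ?n (T (T y)) * ?n y" for y
    unfolding L2_set_power2 using sym ip_le_L2_set[of V "T (T y)" y] by metis
  show ?thesis
  proof (cases "?n (T x) = 0")
    case False
    have "?n (T x) * ?n (T x) ^ 3 = ((?n (T x))\<^sup>2)\<^sup>2" by (simp add: eval_nat_numeral)
    also have "\<dots> \<le> (?n (T (T x)) * ?n x)\<^sup>2" using step[of x] by (rule power_mono) simp
    also have "\<dots> = (?n (T (T x)))\<^sup>2 * (?n x)\<^sup>2" by (rule power_mult_distrib)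
    also have "\<dots> \<le> (?n (T (T (T x))) * ?n (T x)) * (?n x)\<^sup>2"
      using step[of "T x"] by (rule mult_right_mono) simp
    finally have "?n (T x) * ?n (T x) ^ 3 \<le> ?n (T x) * (?n (T (T (T x))) * ?n x ^ 2)"
      by (simp add: mult_ac)
    with False nn[of "T x"] show ?thesis by (metis mult_le_cancel_left_pos order_le_less)
  qed (use nn in simp)
qed

text \<open>\<open>f_bound\<close> is the larger root of X^2 - (1 - l2^2) l1 X - l2^2. For 0 < l2 <
  1 the eigenvalue bound uses only this equation and \<open>f_bound_ge\<close>.\<close>

lemma f_bound_root:
  "f_bound l1 l2 ^ 2 = (1 - l2\<^sup>2) * l1 * f_bound l1 l2 + l2\<^sup>2"
proof -
  let ?s = "sqrt ((1 - l2\<^sup>2)\<^sup>2 * l1\<^sup>2 + 4 * l2\<^sup>2)"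
  have "?s\<^sup>2 = (1 - l2\<^sup>2)\<^sup>2 * l1\<^sup>2 + 4 * l2\<^sup>2" by simp
  moreover have "2 * f_bound l1 l2 = (1 - l2\<^sup>2) * l1 + ?s" by (simp add: f_bound_def)
  then have "(2 * f_bound l1 l2 - (1 - l2\<^sup>2) * l1)\<^sup>2 = ?s\<^sup>2" by simp
  ultimately show ?thesis by (simp add: power2_eq_square algebra_simps)
qed

text \<open>Dropping the l1 term under the root leaves 2 l2. For 0 < l2 < 1 it follows that l2^2 <
  f, which makes the operator f - l2^2 A positive.\<close>

lemma f_bound_ge:
  assumes "0 \<le> l1" "0 \<le> l2" "l2 \<le> 1"
  shows "l2 \<le> f_bound l1 l2" "0 \<le> f_bound l1 l2"
proof -
  have "sqrt ((2 * l2)\<^sup>2) \<le> sqrt ((1 - l2\<^sup>2)\<^sup>2 * l1\<^sup>2 + 4 * l2\<^sup>2)"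
    by (rule real_sqrt_le_mono) (simp add: power_mult_distrib)
  then have "2 * l2 \<le> sqrt ((1 - l2\<^sup>2)\<^sup>2 * l1\<^sup>2 + 4 * l2\<^sup>2)"
    unfolding real_sqrt_abs using assms by linarith
  moreover have "0 \<le> (1 - l2\<^sup>2) * l1" using assms by (simp add: power_le_one)
  ultimately show "l2 \<le> f_bound l1 l2" unfolding f_bound_def by simp
  with assms show "0 \<le> f_bound l1 l2" by simp
qed

lemma f_bound_less_1:
  assumes "0 \<le> l1" "l1 < 1" "0 \<le> l2" "l2 < 1"
  shows "f_bound l1 l2 < 1"
proof -
  define s where "s = 1 - l2\<^sup>2"
  have s: "0 < s" "s \<le> 1" using assms by (simp_all add: s_def power_less_one_iff abs_square_less_1)
  have "s * l1 < s" using s assms by simp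
  \<comment> \<open>Since 4 l2^2 = 4 - 4 s, this reduces to s l1 < s.\<close>
  then have "s\<^sup>2 * l1\<^sup>2 + 4 * l2\<^sup>2 < (2 - s * l1)\<^sup>2"
    by (simp add: s_def power2_eq_square algebra_simps)
  moreover have "0 \<le> 2 - s * l1" using \<open>s * l1 < s\<close> s by linarith
  ultimately have "sqrt (s\<^sup>2 * l1\<^sup>2 + 4 * l2\<^sup>2) < 2 - s * l1"
    using real_less_lsqrt by blast
  then show ?thesis unfolding f_bound_def s_def by simp
qed

text \<open>With \<open>A x = x \<circ> \<sigma>\<close> and \<open>K = f - \<epsilon> l2\<^sup>2 A\<close>, a positive operator with inverse
  \<open>(f + \<epsilon> l2\<^sup>2 A) / (f\<^sup>2 - l2\<^sup>4)\<close>, this is the Cauchy-Schwarz inequality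
  \<open>\<langle>z, y\<rangle>\<^sup>2 \<le> \<langle>K y, y\<rangle> \<langle>K\<^sup>-\<^sup>1 z, z\<rangle>\<close> for the projection \<open>z\<close> of \<open>y\<close>.\<close>

lemma involution_form_le:
  fixes f l1 l2 \<epsilon> :: real
  assumes \<sigma>: "\<And>v. v \<in> V \<Longrightarrow> \<sigma> v \<in> V" "\<And>v. v \<in> V \<Longrightarrow> \<sigma> (\<sigma> v) = v"
    and root: "f\<^sup>2 = (1 - l2\<^sup>2) * l1 * f + l2\<^sup>2"
    and f: "l2\<^sup>2 < f" and l2: "l2\<^sup>2 \<le> 1" and \<epsilon>: "\<epsilon> = 1 \<or> \<epsilon> = -1"
    and proj: "ip V z y = ip V z z"
    and z: "\<epsilon> * ip V (\<lambda>v. z (\<sigma> v)) z \<le> l1 * ip V z z"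
  shows "\<epsilon> * l2\<^sup>2 * ip V (\<lambda>v. y (\<sigma> v)) y \<le> f * ip V y y - (1 - l2\<^sup>2) * f * ip V z z"
proof -
  have reidx: "(\<Sum>v\<in>V. h (\<sigma> v)) = sum h V" for h :: "'a \<Rightarrow> real"
    by (rule sum.reindex_bij_witness[of _ \<sigma> \<sigma>]) (auto simp: \<sigma>)
  have isom: "ip V (\<lambda>v. x (\<sigma> v)) (\<lambda>v. y (\<sigma> v)) = ip V x y" for x y
    unfolding ip_def by (rule reidx[of "\<lambda>v. x v * y v"])
  have symA: "ip V (\<lambda>v. x (\<sigma> v)) y = ip V x (\<lambda>v. y (\<sigma> v))" for x y
    unfolding isom[of x "\<lambda>v. y (\<sigma> v)", symmetric] by (rule ip_cong) (simp_all add: \<sigma>)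
  have \<epsilon>2: "\<epsilon> * \<epsilon> = 1" using \<epsilon> by auto
  define L where "L = l2\<^sup>2"
  define s where "s = (1 - L) * f"
  have L0: "0 \<le> L" by (simp add: L_def)
  have f0: "f > 0" using f zero_le_power2[of l2] by linarith
  have s0: "s \<ge> 0" using f0 l2 by (simp add: s_def L_def)
  have den: "f\<^sup>2 - L\<^sup>2 > 0" using power_strict_mono[OF f, of 2] by (simp add: L_def)
  \<comment> \<open>Here s is the reciprocal of (f + L l1) / (f^2 - L^2), the bound on the form of
    K^-1 at z relative to <z, z>. With this c, the vector \<open>u\<close> below is y - s K^-1 z,
    and <K u, u> >= 0 yields the claim.\<close>
  define c where "c = s / (f\<^sup>2 - L\<^sup>2)"
  have cden: "c * (f\<^sup>2 - L\<^sup>2) = s" using den by (simp add: c_def)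
  define n where "n = ip V z z"
  define a where "a = ip V y y"
  define b where "b = \<epsilon> * ip V (\<lambda>v. y (\<sigma> v)) y"
  define e where "e = \<epsilon> * ip V z (\<lambda>v. y (\<sigma> v))"
  define r where "r = \<epsilon> * ip V (\<lambda>v. z (\<sigma> v)) z"
  define u where "u = (\<lambda>v. y v - c * f * z v - c * L * \<epsilon> * z (\<sigma> v))"
  have eqs: "ip V y z = n" "ip V z y = n" "ip V (\<lambda>v. z (\<sigma> v)) (\<lambda>v. y (\<sigma> v)) = n"
      "ip V (\<lambda>v. y (\<sigma> v)) (\<lambda>v. z (\<sigma> v)) = n" "ip V (\<lambda>v. z (\<sigma> v)) (\<lambda>v. z (\<sigma> v)) = n" "ip V z z = n"
    and eqs2: "ip V (\<lambda>v. z (\<sigma> v)) y = \<epsilon> * e" "ip V y (\<lambda>v. z (\<sigma> v)) = \<epsilon> * e"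
       "ip V z (\<lambda>v. y (\<sigma> v)) = \<epsilon> * e" "ip V (\<lambda>v. y (\<sigma> v)) z = \<epsilon> * e"
       "ip V z (\<lambda>v. z (\<sigma> v)) = \<epsilon> * r" "ip V (\<lambda>v. z (\<sigma> v)) z = \<epsilon> * r"
       "ip V (\<lambda>v. y (\<sigma> v)) y = \<epsilon> * b"
    using proj \<epsilon>2 symA[of z y] symA[of z z] ip_commute[of V y z] ip_commute[of V "\<lambda>v. y (\<sigma> v)" "\<lambda>v. z (\<sigma> v)"]
      ip_commute[of V y "\<lambda>v. z (\<sigma> v)"] ip_commute[of V "\<lambda>v. y (\<sigma> v)" z]
    by (simp_all add: n_def e_def r_def b_def isom mult.assoc[symmetric])
  have \<epsilon>3: "\<epsilon> * (\<epsilon> * x) = x" for x using \<epsilon> by auto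
  have uu: "ip V u u = a - 2*c*f*n - 2*c*L*e + c\<^sup>2*f\<^sup>2*n + 2*c\<^sup>2*f*L*r + c\<^sup>2*L\<^sup>2*n"
    unfolding u_def ip_linear mult.assoc[of _ _ "_ (\<sigma> _)"] eqs eqs2 a_def[symmetric]
    by (simp add: algebra_simps power2_eq_square \<epsilon>2 \<epsilon>3)
  have Auu: "\<epsilon> * ip V (\<lambda>v. u (\<sigma> v)) u = b - 2*c*f*e - 2*c*L*n + c\<^sup>2*f\<^sup>2*r + 2*c\<^sup>2*f*L*n + c\<^sup>2*L\<^sup>2*r"
  proof -
    have "ip V (\<lambda>v. u (\<sigma> v)) u =
      ip V (\<lambda>v. y (\<sigma> v) - c * f * z (\<sigma> v) - c * L * \<epsilon> * z v) (\<lambda>v. y v - c * f * z v - c * L * \<epsilon> * z (\<sigma> v))"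
      by (rule ip_cong) (simp_all add: u_def \<sigma>)
    also have "\<dots> = \<epsilon> * (b - 2*c*f*e - 2*c*L*n + c\<^sup>2*f\<^sup>2*r + 2*c\<^sup>2*f*L*n + c\<^sup>2*L\<^sup>2*r)"
      unfolding ip_linear eqs eqs2 by (simp add: algebra_simps power2_eq_square \<epsilon>2 \<epsilon>3)
    finally show ?thesis by (simp add: \<epsilon>3)
  qed
  \<comment> \<open>The involution is an isometry, so its form is at most <u, u>; with L < f this
    makes K positive.\<close>
  have "\<epsilon> * ip V (\<lambda>v. u (\<sigma> v)) u \<le> ip V u u"
  proof -
    have "0 \<le> ip V (\<lambda>v. u v - \<epsilon> * u (\<sigma> v)) (\<lambda>v. u v - \<epsilon> * u (\<sigma> v))" by (rule ip_nonneg)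
    also have "\<dots> = 2 * ip V u u - 2 * \<epsilon> * ip V (\<lambda>v. u (\<sigma> v)) u"
      unfolding ip_linear isom symA[of u u, symmetric] 
      by (simp add: ip_commute[of V u "\<lambda>v. u (\<sigma> v)"] algebra_simps \<epsilon>3)
    finally show ?thesis by simp
  qed
  then have "L * (\<epsilon> * ip V (\<lambda>v. u (\<sigma> v)) u) \<le> f * ip V u u"
    using f L0 ip_nonneg[of V u] by (intro order_trans[OF mult_left_mono[OF _ L0] mult_right_mono]) (auto simp: L_def)
  then have "0 \<le> f * ip V u u - L * (\<epsilon> * ip V (\<lambda>v. u (\<sigma> v)) u)" by simp
  also have "\<dots> = f * a - L * b - 2 * s * n + s * c * (f * n + L * r)"
    unfolding uu Auu cden[symmetric] by (simp add: algebra_simps power2_eq_square)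
  also have "s * c * (f * n + L * r) \<le> s * c * (f * n + L * (l1 * n))"
    using z s0 den L0 unfolding r_def[symmetric] n_def[symmetric]
    by (intro mult_left_mono add_left_mono) (auto simp: c_def)
  also have "s * c * (f * n + L * (l1 * n)) = s * n"
  proof -
    \<comment> \<open>The quadratic equation for f enters here and turns -2 s n into -s n.\<close>
    have "s * (f + L * l1) = f\<^sup>2 - L\<^sup>2"
      using root unfolding s_def L_def[symmetric] by algebra
    have "s * c * (f * n + L * (l1 * n)) = c * (s * (f + L * l1)) * n" by (simp add: algebra_simps)
    then show ?thesis using cden \<open>s * (f + L * l1) = f\<^sup>2 - L\<^sup>2\<close> by simp
  qed
  finally show ?thesis by (simp add: s_def L_def a_def b_def n_def algebra_simps)
qed

section \<open>The second eigenvalue of a regular graph\<close>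

declare One_nat_def [simp del]

lemma
  assumes "regular_graph G"
  shows finite_verts: "finite (verts G)" and verts_nonempty: "verts G \<noteq> {}" and deg_pos: "deg G > 0"
  using assms unfolding regular_graph_def by auto

lemma rot_rot:
  assumes "regular_graph G" "e \<in> verts G \<times> {1..deg G}"
  shows "rot G e \<in> verts G \<times> {1..deg G}" "rot G (rot G e) = e"
  using assms unfolding regular_graph_def by blast+

text \<open>For fixed u and v the label i determines j, so the entry counts the labels i leading to
  v. Grouping the labels by endpoint leaves a sum over edges, which \<open>rot G\<close> can
  re-index.\<close>

lemma adj_mult_eq:
  assumes "regular_graph G" "u \<in> verts G"
  shows "adj_mult G x u = (\<Sum>i=1..deg G. x (fst (rot G (u, i)))) / deg G"
proof -
  let ?D = "{1..deg G}"
  have r: "rot G (u, i) \<in> verts G \<times> ?D" if "i \<in> ?D" for i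
    by (rule rot_rot(1)[OF assms(1)]) (use assms(2) that in simp)
  have c: "card {(i, j). i \<in> ?D \<and> j \<in> ?D \<and> rot G (u, i) = (v, j)} = card {i \<in> ?D. fst (rot G (u, i)) = v}"
    for v
  proof -
    have "{(i, j). i \<in> ?D \<and> j \<in> ?D \<and> rot G (u, i) = (v, j)} =
        (\<lambda>i. (i, snd (rot G (u, i)))) ` {i \<in> ?D. fst (rot G (u, i)) = v}"
    proof (intro set_eqI iffI)
      fix y assume "y \<in> {(i, j). i \<in> ?D \<and> j \<in> ?D \<and> rot G (u, i) = (v, j)}"
      then show "y \<in> (\<lambda>i. (i, snd (rot G (u, i)))) ` {i \<in> ?D. fst (rot G (u, i)) = v}"
        by (intro image_eqI[of _ _ "fst y"]) auto
    next
      fix y assume "y \<in> (\<lambda>i. (i, snd (rot G (u, i)))) ` {i \<in> ?D. fst (rot G (u, i)) = v}"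
      then obtain i where i: "i \<in> ?D" "fst (rot G (u, i)) = v" "y = (i, snd (rot G (u, i)))" by blast
      with r[OF i(1)] show "y \<in> {(i, j). i \<in> ?D \<and> j \<in> ?D \<and> rot G (u, i) = (v, j)}"
        by (auto simp: mem_Times_iff)
    qed
    then show ?thesis by (simp add: card_image inj_on_def)
  qed
  have "deg G * adj_mult G x u = (\<Sum>v\<in>verts G. card {i \<in> ?D. fst (rot G (u, i)) = v} * x v)"
    unfolding adj_mult_def adj_def c using deg_pos[OF assms(1)]
    by (simp add: sum_distrib_left)
  also have "\<dots> = (\<Sum>v\<in>verts G. \<Sum>i | i \<in> ?D \<and> fst (rot G (u, i)) = v. x (fst (rot G (u, i))))"
    by (rule sum.cong) auto
  also have "\<dots> = (\<Sum>i\<in>?D. x (fst (rot G (u, i))))"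
    by (rule sum.group) (use finite_verts[OF assms(1)] r in \<open>simp_all add: image_subset_iff mem_Times_iff\<close>)
  finally show ?thesis using deg_pos[OF assms(1)] by (simp add: field_simps)
qed

text \<open>The involution \<open>rot G\<close> permutes the half-edges. Preservation of sums,
  symmetry and contractivity of the adjacency matrix rest on this re-indexing.\<close>

lemma sum_rot:
  assumes "regular_graph G"
  shows "(\<Sum>e\<in>verts G \<times> {1..deg G}. h (rot G e)) = (\<Sum>e\<in>verts G \<times> {1..deg G}. h e)"
  by (rule sum.reindex_bij_witness[of _ "rot G" "rot G"]) (simp_all only: rot_rot[OF assms])

lemma sum_adj_mult:
  assumes "regular_graph G"
  shows "sum (adj_mult G x) (verts G) = sum x (verts G)"
proof -
  have "deg G * sum (adj_mult G x) (verts G) = (\<Sum>u\<in>verts G. \<Sum>i=1..deg G. x (fst (rot G (u, i))))"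
    unfolding sum_distrib_left using deg_pos[OF assms]
    by (intro sum.cong) (simp_all add: adj_mult_eq[OF assms])
  also have "\<dots> = (\<Sum>e\<in>verts G \<times> {1..deg G}. x (fst (rot G e)))"
    by (simp add: sum.cartesian_product split_def)
  also have "\<dots> = (\<Sum>e\<in>verts G \<times> {1..deg G}. x (fst e))"
    by (rule sum_rot[OF assms])
  also have "\<dots> = deg G * sum x (verts G)"
    using sum.cartesian_product[of "\<lambda>v i. x v" "{1..deg G}" "verts G"]
    by (simp add: split_def sum_distrib_left)
  finally show ?thesis using deg_pos[OF assms] by simp
qed

lemma ip_adj_mult_sym:
  assumes "regular_graph G"
  shows "ip (verts G) (adj_mult G x) y = ip (verts G) x (adj_mult G y)"
proof -
  have eq: "deg G * ip (verts G) (adj_mult G x) y = (\<Sum>e\<in>verts G \<times> {1..deg G}. x (fst (rot G e)) * y (fst e))"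
    for x y
  proof -
    have "deg G * ip (verts G) (adj_mult G x) y = (\<Sum>u\<in>verts G. \<Sum>i=1..deg G. x (fst (rot G (u, i))) * y u)"
      unfolding ip_def sum_distrib_left using deg_pos[OF assms]
      by (intro sum.cong) (simp_all add: adj_mult_eq[OF assms] sum_distrib_right)
    then show ?thesis by (simp add: sum.cartesian_product split_def)
  qed
  have "deg G * ip (verts G) (adj_mult G x) y =
      (\<Sum>e\<in>verts G \<times> {1..deg G}. (\<lambda>e. x (fst e) * y (fst (rot G e))) (rot G e))"
    unfolding eq
    by (intro sum.cong refl) (simp only: rot_rot(2)[OF assms])
  also have "\<dots> = deg G * ip (verts G) (adj_mult G y) x"
    unfolding eq by (subst sum_rot[OF assms]) (simp add: mult.commute)
  finally show ?thesis using deg_pos[OF assms] by (simp add: ip_commute)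
qed

text \<open>Cauchy-Schwarz over the labels at each vertex, then re-indexing of the half-edges. It
  also bounds the set whose supremum is the second eigenvalue.\<close>

lemma sum_square_adj_mult_le:
  assumes "regular_graph G"
  shows "ip (verts G) (adj_mult G x) (adj_mult G x) \<le> ip (verts G) x x"
proof -
  have D: "deg G > 0" by (rule deg_pos[OF assms])
  have "deg G * ip (verts G) (adj_mult G x) (adj_mult G x) =
    (\<Sum>u\<in>verts G. (\<Sum>i=1..deg G. x (fst (rot G (u, i))))\<^sup>2 / deg G)"
    unfolding ip_def sum_distrib_left using D
    by (intro sum.cong) (simp_all add: adj_mult_eq[OF assms] power2_eq_square)
  also have "\<dots> \<le> (\<Sum>u\<in>verts G. \<Sum>i=1..deg G. (x (fst (rot G (u, i))))\<^sup>2)"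
  proof (rule sum_mono)
    fix u
    have "(\<Sum>i=1..deg G. x (fst (rot G (u, i))))\<^sup>2 \<le> (\<Sum>i=1..deg G. (x (fst (rot G (u, i))))\<^sup>2) * (\<Sum>i=1..deg G. 1\<^sup>2)"
      using Cauchy_Schwarz_ineq_sum[of "\<lambda>i. x (fst (rot G (u, i)))" "\<lambda>_. 1" "{1..deg G}"] by simp
    then show "(\<Sum>i=1..deg G. x (fst (rot G (u, i))))\<^sup>2 / deg G \<le> (\<Sum>i=1..deg G. (x (fst (rot G (u, i))))\<^sup>2)"
      using D by (simp add: divide_le_eq)
  qed
  also have "\<dots> = (\<Sum>e\<in>verts G \<times> {1..deg G}. (x (fst (rot G e)))\<^sup>2)"
    by (simp add: sum.cartesian_product split_def)
  also have "\<dots> = (\<Sum>e\<in>verts G \<times> {1..deg G}. (x (fst e))\<^sup>2)"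
    by (rule sum_rot[OF assms])
  also have "\<dots> = deg G * ip (verts G) x x"
    using sum.cartesian_product[of "\<lambda>v i. (x v)\<^sup>2" "{1..deg G}" "verts G"]
    by (simp add: split_def sum_distrib_left ip_def power2_eq_square)
  finally show ?thesis using D by simp
qed

lemma L2_set_adj_mult_le:
  assumes "regular_graph G"
  shows "L2_set (adj_mult G x) (verts G) \<le> L2_set x (verts G)"
  unfolding L2_set_eq_sqrt_ip using sum_square_adj_mult_le[OF assms] by simp

lemma L2_set_adj_mult_le_second_eigenvalue:
  assumes "regular_graph G" "second_eigenvalue G \<le> l" "sum x (verts G) = 0"
  shows "L2_set (adj_mult G x) (verts G) \<le> l * L2_set x (verts G)"
proof (cases "\<exists>v\<in>verts G. x v \<noteq> 0")
  case False
  then have "L2_set x (verts G) = 0" by (simp add: L2_set_def)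
  with L2_set_adj_mult_le[OF assms(1), of x] L2_set_nonneg[of "adj_mult G x" "verts G"] show ?thesis by simp
next
  case True
  have fin: "finite (verts G)" by (rule finite_verts[OF assms(1)])
  have pos: "L2_set x (verts G) > 0"
    using True fin by (metis L2_set_eq_0_iff L2_set_nonneg order_le_less)
  \<comment> \<open>On a single vertex, sum 0 would force x = 0, so the case of the default value 0
    does not arise.\<close>
  have "card (verts G) \<noteq> 1"
  proof
    assume "card (verts G) = 1"
    then obtain v where "verts G = {v}" by (rule card_1_singletonE)
    with True assms(3) show False by simp
  qed
  let ?S = "{L2_set (adj_mult G \<alpha>) (verts G) / L2_set \<alpha> (verts G) | \<alpha>.
                  (\<Sum>v \<in> verts G. \<alpha> v) = 0 \<and> (\<exists>v \<in> verts G. \<alpha> v \<noteq> 0)}"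
  have "L2_set (adj_mult G x) (verts G) / L2_set x (verts G) \<le> Sup ?S"
  proof (rule cSup_upper)
    show "bdd_above ?S"
    proof (rule bdd_aboveI[of _ 1])
      fix q assume "q \<in> ?S"
      then obtain y where "q = L2_set (adj_mult G y) (verts G) / L2_set y (verts G)" by blast
      then show "q \<le> 1"
        using L2_set_adj_mult_le[OF assms(1), of y] L2_set_nonneg[of y "verts G"]
        by (auto simp: divide_le_eq_1 order_le_less)
    qed
  qed (use assms(3) True in blast)
  also have "\<dots> \<le> l" using assms(2) \<open>card (verts G) \<noteq> 1\<close> by (simp add: second_eigenvalue_def)
  finally show ?thesis using pos by (simp add: divide_le_eq)
qed

lemma second_eigenvalue_le:
  assumes "regular_graph G" "c \<ge> 0"
    and bound: "\<And>x. sum x (verts G) = 0 \<Longrightarrow> L2_set (adj_mult G x) (verts G) \<le> c * L2_set x (verts G)"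
  shows "second_eigenvalue G \<le> c"
proof (cases "card (verts G) = 1")
  case True
  then show ?thesis using assms by (simp add: second_eigenvalue_def)
next
  case False
  have fin: "finite (verts G)" "verts G \<noteq> {}" using finite_verts verts_nonempty assms(1) by auto
  then obtain u where u: "u \<in> verts G" by blast
  have "verts G \<noteq> {u}" using False by auto
  with u obtain w where w: "w \<in> verts G" "w \<noteq> u" by blast
  \<comment> \<open>A witness that the set under the supremum is nonempty.\<close>
  define y :: "'a \<Rightarrow> real" where "y = (\<lambda>v. if v = u then 1 else if v = w then -1 else 0)"
  have "sum y (verts G) = sum y {u, w}"
    by (rule sum.mono_neutral_right) (use fin u w in \<open>auto simp: y_def\<close>)
  then have y: "sum y (verts G) = 0" "\<exists>v\<in>verts G. y v \<noteq> 0"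
    using u w by (auto simp: y_def)
  have "Sup {L2_set (adj_mult G \<alpha>) (verts G) / L2_set \<alpha> (verts G) | \<alpha>.
                  (\<Sum>v \<in> verts G. \<alpha> v) = 0 \<and> (\<exists>v \<in> verts G. \<alpha> v \<noteq> 0)} \<le> c"
  proof (rule cSup_least)
    fix q assume "q \<in> {L2_set (adj_mult G \<alpha>) (verts G) / L2_set \<alpha> (verts G) | \<alpha>.
                  (\<Sum>v \<in> verts G. \<alpha> v) = 0 \<and> (\<exists>v \<in> verts G. \<alpha> v \<noteq> 0)}"
    then obtain x where x: "q = L2_set (adj_mult G x) (verts G) / L2_set x (verts G)"
      "sum x (verts G) = 0" "\<exists>v \<in> verts G. x v \<noteq> 0" by blast
    have "L2_set x (verts G) > 0"
      using x(3) fin by (metis L2_set_eq_0_iff L2_set_nonneg order_le_less)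
    with bound[OF x(2)] show "q \<le> c" by (simp add: x(1) divide_le_eq)
  qed (use y in blast)
  then show ?thesis using False by (simp add: second_eigenvalue_def)
qed

lemma adj_mult_linear: "adj_mult G (\<lambda>v. a * x v + b * y v) u = a * adj_mult G x u + b * adj_mult G y u"
  by (simp add: adj_mult_def algebra_simps sum.distrib sum_distrib_left)

section \<open>The spectrum of the replacement product\<close>

locale replacement =
  fixes G1 :: "'v rgraph" and G2 :: "nat rgraph"
  assumes reg1: "regular_graph G1" and reg2: "regular_graph G2" and verts2: "verts G2 = {1..deg G1}"
begin

abbreviation "V \<equiv> verts G1 \<times> {1..deg G1}"
abbreviation "nrm x \<equiv> L2_set x V"
abbreviation "D \<equiv> real (deg G2)"

definition A :: "('v \<times> nat \<Rightarrow> real) \<Rightarrow> 'v \<times> nat \<Rightarrow> real" where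
  "A x = (\<lambda>e. x (rot G1 e))"

definition B :: "('v \<times> nat \<Rightarrow> real) \<Rightarrow> 'v \<times> nat \<Rightarrow> real" where
  "B x = (\<lambda>(v, k). adj_mult G2 (\<lambda>l. x (v, l)) k)"

definition avg :: "('v \<times> nat \<Rightarrow> real) \<Rightarrow> 'v \<Rightarrow> real" where
  "avg x v = (\<Sum>l=1..deg G1. x (v, l)) / deg G1"

text \<open>Orthogonal projection onto the vectors constant on every cloud
  \<open>{v} \<times> {1..deg G1}\<close>.\<close>

definition proj :: "('v \<times> nat \<Rightarrow> real) \<Rightarrow> 'v \<times> nat \<Rightarrow> real" where
  "proj x = (\<lambda>(v, k). avg x v)"

lemma finite_V: "finite V" and deg1_pos: "deg G1 > 0" and deg2_pos: "deg G2 > 0"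
  using finite_verts deg_pos reg1 reg2 by auto

lemma rot1: "e \<in> V \<Longrightarrow> rot G1 e \<in> V" "e \<in> V \<Longrightarrow> rot G1 (rot G1 e) = e"
  using rot_rot[OF reg1] by blast+

lemma sum_V: "sum h V = (\<Sum>v\<in>verts G1. \<Sum>k=1..deg G1. h (v, k))" for h :: "_ \<Rightarrow> real"
  by (simp add: sum.cartesian_product)

lemma ip_V: "ip V x y = (\<Sum>v\<in>verts G1. ip {1..deg G1} (\<lambda>k. x (v, k)) (\<lambda>k. y (v, k)))"
  unfolding ip_def by (rule sum_V)

lemma regular_replacement: "regular_graph (replacement_product G1 G2)"
  unfolding regular_graph_def
proof (intro conjI ballI)
  let ?G = "replacement_product G1 G2"
  show "finite (verts ?G)" "verts ?G \<noteq> {}" "1 \<le> deg ?G"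
    using verts_nonempty[OF reg1] finite_V deg1_pos by (auto simp: replacement_product_def)
  fix x assume "x \<in> verts ?G \<times> {1..deg ?G}"
  then obtain v k i where x: "x = ((v, k), i)" "v \<in> verts G1" "k \<in> {1..deg G1}" "i \<in> {1..deg G2 + 1}"
    by (auto simp: replacement_product_def)
  show "rot ?G x \<in> verts ?G \<times> {1..deg ?G}" "rot ?G (rot ?G x) = x"
  proof -
    have "rot ?G x \<in> verts ?G \<times> {1..deg ?G} \<and> rot ?G (rot ?G x) = x"
    proof (cases "i \<le> deg G2")
      case True
      obtain m j where mj: "rot G2 (k, i) = (m, j)" by fastforce
      have "(k, i) \<in> verts G2 \<times> {1..deg G2}" using x True verts2 by auto
      from rot_rot[OF reg2 this] show ?thesis using x True mj verts2 by (auto simp: replacement_product_def)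
    next
      case False
      obtain w m where wm: "rot G1 (v, k) = (w, m)" by fastforce
      with rot1[of "(v, k)"] x False show ?thesis by (auto simp: replacement_product_def)
    qed
    then show "rot ?G x \<in> verts ?G \<times> {1..deg ?G}" "rot ?G (rot ?G x) = x" by auto
  qed
qed

lemma verts_replacement: "verts (replacement_product G1 G2) = V"
  and deg_replacement: "deg (replacement_product G1 G2) = deg G2 + 1"
  by (simp_all add: replacement_product_def)

text \<open>The labels up to \<open>deg G2\<close> stay in the cloud and contribute D B; the last
  one follows an edge of G1 and contributes A.\<close>

lemma adj_mult_replacement:
  assumes "e \<in> V"
  shows "(D + 1) * adj_mult (replacement_product G1 G2) x e = D * B x e + A x e"
proof -
  obtain v k where e: "e = (v, k)" "v \<in> verts G1" "k \<in> {1..deg G1}" using assms by auto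
  let ?G = "replacement_product G1 G2"
  have "(D + 1) * adj_mult ?G x e = (\<Sum>i=1..deg G2 + 1. x (fst (rot ?G (e, i))))"
    using adj_mult_eq[OF regular_replacement, of e x] assms by (simp add: verts_replacement deg_replacement add.commute)
  also have "\<dots> = (\<Sum>i=1..deg G2. x (fst (rot ?G (e, i)))) + x (fst (rot ?G (e, deg G2 + 1)))"
    by (simp add: sum.cl_ivl_Suc One_nat_def)
  also have "x (fst (rot ?G (e, deg G2 + 1))) = A x e"
    by (simp add: replacement_product_def e A_def)
  also have "(\<Sum>i=1..deg G2. x (fst (rot ?G (e, i)))) = (\<Sum>i=1..deg G2. x (v, fst (rot G2 (k, i))))"
    by (rule sum.cong) (auto simp: replacement_product_def e split: prod.split)
  also have "\<dots> = D * B x e"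
    using adj_mult_eq[OF reg2, of k "\<lambda>l. x (v, l)"] e verts2 deg2_pos by (simp add: B_def)
  finally show ?thesis .
qed

section \<open>Symmetry and contractivity of A and B, and their action on cloud averages\<close>

lemma A_linear: "A (\<lambda>e. a * x e + b * y e) e = a * A x e + b * A y e"
  by (simp add: A_def)

lemma B_linear: "B (\<lambda>e. a * x e + b * y e) e = a * B x e + b * B y e"
  by (simp add: B_def adj_mult_linear split: prod.split)

lemma A_cong: "(\<And>e. e \<in> V \<Longrightarrow> x e = y e) \<Longrightarrow> e \<in> V \<Longrightarrow> A x e = A y e"
  by (simp add: A_def rot1(1))

lemma B_cong: "(\<And>e. e \<in> V \<Longrightarrow> x e = y e) \<Longrightarrow> e \<in> V \<Longrightarrow> B x e = B y e"
  by (auto simp: B_def adj_mult_def verts2 intro!: sum.cong)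

lemma sum_A: "sum (A x) V = sum x V"
  unfolding A_def by (rule sum_rot[OF reg1])

lemma sum_B: "sum (B x) V = sum x V"
  unfolding sum_V B_def using sum_adj_mult[OF reg2] by (simp add: verts2)

lemma ip_A: "ip V (A x) (A y) = ip V x y"
  using sum_rot[OF reg1, of "\<lambda>e. x e * y e"] by (simp add: ip_def A_def)

lemma A_sym: "ip V (A x) y = ip V x (A y)"
proof -
  have "ip V (A x) y = ip V (A x) (A (A y))" by (rule ip_cong) (auto simp: A_def rot1)
  then show ?thesis by (simp add: ip_A)
qed

lemma B_sym: "ip V (B x) y = ip V x (B y)"
  unfolding ip_V B_def using ip_adj_mult_sym[OF reg2] by (simp add: verts2)

lemma nrm_A: "nrm (A x) = nrm x"
  by (simp add: L2_set_eq_sqrt_ip ip_A)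

lemma ip_B_le: "ip V (B x) (B x) \<le> ip V x x"
  unfolding ip_V B_def using sum_square_adj_mult_le[OF reg2] by (simp add: verts2 sum_mono)

lemma nrm_B: "nrm (B x) \<le> nrm x"
  by (simp add: L2_set_eq_sqrt_ip ip_B_le)

text \<open>The columns of the adjacency matrix of G2 sum to 1, so cloud averages survive: x and B x
  have the same part constant on clouds.\<close>

lemma avg_B: "v \<in> verts G1 \<Longrightarrow> avg (B x) v = avg x v"
  using sum_adj_mult[OF reg2, of "\<lambda>l. x (v, l)"] by (simp add: avg_def B_def verts2)

lemma proj_B: "e \<in> V \<Longrightarrow> proj (B x) e = proj x e"
  by (auto simp: proj_def avg_B)

lemma sum_fibre: "(\<Sum>k=1..deg G1. x (v, k)) = deg G1 * avg x v"
  using deg1_pos by (simp add: avg_def)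

lemma ip_proj: "ip V (proj x) y = (\<Sum>v\<in>verts G1. deg G1 * avg x v * avg y v)"
proof -
  have "ip V (proj x) y = (\<Sum>v\<in>verts G1. avg x v * (\<Sum>k=1..deg G1. y (v, k)))"
    unfolding ip_def sum_V by (simp add: proj_def sum_distrib_left)
  then show ?thesis by (simp add: sum_fibre mult_ac)
qed

lemma avg_proj: "avg (proj x) v = avg x v"
  using deg1_pos by (simp add: avg_def proj_def)

lemma ip_proj_proj: "ip V (proj x) (proj y) = ip V (proj x) y"
  unfolding ip_proj avg_proj ..

lemma pythagoras: "ip V x x = ip V (proj x) (proj x) + ip V (\<lambda>e. x e - proj x e) (\<lambda>e. x e - proj x e)"
  by (simp add: ip_linear ip_proj_proj ip_commute[of V x "proj x"])

text \<open>On vectors constant on clouds, the forms of A and of the identity are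
  \<open>deg G1\<close> times those of the adjacency matrix of G1 and of the identity at
  \<open>avg x\<close>, which inherits sum 0 from x.\<close>

lemma ip_A_proj_le:
  assumes "second_eigenvalue G1 \<le> l1" "sum x V = 0"
  shows "\<bar>ip V (A (proj x)) (proj x)\<bar> \<le> l1 * ip V (proj x) (proj x)"
proof -
  let ?a = "avg x"
  have "sum ?a (verts G1) = 0"
    using assms(2) by (simp add: sum_V avg_def flip: sum_divide_distrib)
  from L2_set_adj_mult_le_second_eigenvalue[OF reg1 assms(1) this]
  have le: "L2_set (adj_mult G1 ?a) (verts G1) \<le> l1 * L2_set ?a (verts G1)" .
  have "ip V (A (proj x)) (proj x) = (\<Sum>v\<in>verts G1. \<Sum>k=1..deg G1. ?a (fst (rot G1 (v, k))) * ?a v)"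
    by (simp add: ip_def sum_V A_def proj_def split_def)
  also have "\<dots> = (\<Sum>v\<in>verts G1. deg G1 * adj_mult G1 ?a v * ?a v)"
    using deg1_pos by (intro sum.cong refl) (simp add: adj_mult_eq[OF reg1] sum_distrib_right)
  also have "\<dots> = deg G1 * ip (verts G1) (adj_mult G1 ?a) ?a"
    by (simp add: ip_def sum_distrib_left mult.assoc)
  finally have 1: "ip V (A (proj x)) (proj x) = deg G1 * ip (verts G1) (adj_mult G1 ?a) ?a" .
  have 2: "ip V (proj x) (proj x) = deg G1 * ip (verts G1) ?a ?a"
    unfolding ip_proj avg_proj by (simp add: ip_def sum_distrib_left mult.assoc)
  have "\<bar>ip (verts G1) (adj_mult G1 ?a) ?a\<bar> \<le> L2_set (adj_mult G1 ?a) (verts G1) * L2_set ?a (verts G1)"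
    using ip_le_L2_set[of "verts G1" "adj_mult G1 ?a" ?a]
      ip_le_L2_set[of "verts G1" "\<lambda>v. (-1) * adj_mult G1 ?a v" ?a]
    unfolding ip_scale by (simp add: L2_set_def)
  also have "\<dots> \<le> l1 * L2_set ?a (verts G1) * L2_set ?a (verts G1)"
    using le by (rule mult_right_mono) (rule L2_set_nonneg)
  also have "\<dots> = l1 * ip (verts G1) ?a ?a"
    by (simp add: L2_set_power2[symmetric] power2_eq_square)
  finally show ?thesis unfolding 1 2 using deg1_pos by (simp add: abs_mult)
qed

text \<open>Within a cloud the adjacency matrix of G2 fixes constants, so subtracting the average
  leaves B acting on a vector of sum 0, where it contracts by l2.\<close>

lemma ip_B_perp_le:
  assumes "second_eigenvalue G2 \<le> l2" "0 \<le> l2"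
  shows "ip V (\<lambda>e. B x e - proj (B x) e) (\<lambda>e. B x e - proj (B x) e)
    \<le> l2\<^sup>2 * ip V (\<lambda>e. x e - proj x e) (\<lambda>e. x e - proj x e)"
  unfolding ip_V sum_distrib_left
proof (rule sum_mono)
  fix v assume v: "v \<in> verts G1"
  define z where "z = (\<lambda>k. x (v, k) - avg x v)"
  have z0: "sum z (verts G2) = 0"
    using deg1_pos by (simp add: z_def sum_subtractf verts2 avg_def)
  have adj_const: "adj_mult G2 (\<lambda>_. 1) k = 1" if "k \<in> verts G2" for k
    using adj_mult_eq[OF reg2 that] deg2_pos by simp
  have Bz: "B x (v, k) - proj (B x) (v, k) = adj_mult G2 z k" if "k \<in> {1..deg G1}" for k
  proof -
    have "adj_mult G2 z k = adj_mult G2 (\<lambda>l. 1 * x (v, l) + (- avg x v) * 1) k"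
      by (simp add: z_def)
    also have "\<dots> = B x (v, k) - avg x v"
      unfolding adj_mult_linear using adj_const that verts2 by (simp add: B_def)
    finally show ?thesis using v by (simp add: proj_def avg_B)
  qed
  have "ip {1..deg G1} (\<lambda>k. B x (v, k) - proj (B x) (v, k)) (\<lambda>k. B x (v, k) - proj (B x) (v, k))
    = (L2_set (adj_mult G2 z) (verts G2))\<^sup>2"
    unfolding L2_set_power2 verts2 by (rule ip_cong) (auto simp: Bz)
  also have "\<dots> \<le> (l2 * L2_set z (verts G2))\<^sup>2"
    using L2_set_adj_mult_le_second_eigenvalue[OF reg2 assms(1) z0]
    by (rule power_mono) (rule L2_set_nonneg)
  also have "\<dots> = l2\<^sup>2 * ip {1..deg G1} (\<lambda>k. x (v, k) - proj x (v, k)) (\<lambda>k. x (v, k) - proj x (v, k))"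
    unfolding power_mult_distrib L2_set_power2 verts2 by (simp add: z_def proj_def)
  finally show "ip {1..deg G1} (\<lambda>k. B x (v, k) - proj (B x) (v, k)) (\<lambda>k. B x (v, k) - proj (B x) (v, k))
    \<le> l2\<^sup>2 * ip {1..deg G1} (\<lambda>k. x (v, k) - proj x (v, k)) (\<lambda>k. x (v, k) - proj x (v, k))" .
qed

text \<open>x and y = B x share the part constant on clouds, of squared norm n, while the rest
  shrinks at least by the factor l2. The inequality from \<open>involution_form_le\<close> carries a
  factor l2^2 to be cancelled, so l2 = 0 is treated apart; for l2 = 1, where f = 1, its hypothesis
  l2^2 < f fails.\<close>

lemma BAB_form_le:
  assumes l1: "second_eigenvalue G1 \<le> l1" "l1 \<in> {0..1}" and l2: "second_eigenvalue G2 \<le> l2" "l2 \<in> {0..1}"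
    and x: "sum x V = 0"
  shows "\<bar>ip V (A (B x)) (B x)\<bar> \<le> f_bound l1 l2 * ip V x x"
proof -
  define y where "y = B x"
  define f where "f = f_bound l1 l2"
  let ?perp = "\<lambda>x e. x e - proj x e"
  define n where "n = ip V (proj x) (proj x)"
  have n: "ip V (proj y) (proj y) = n"
    unfolding n_def by (rule ip_cong) (auto simp: y_def proj_B)
  have n0: "n \<ge> 0" unfolding n_def by (rule ip_nonneg)
  have y0: "sum y V = 0" using x by (simp add: y_def sum_B)
  have f0: "l2 \<le> f" "0 \<le> f" using f_bound_ge l1 l2 by (auto simp: f_def)
  have x_split: "ip V x x = n + ip V (?perp x) (?perp x)" unfolding n_def by (rule pythagoras)
  have y_split: "ip V y y = n + ip V (?perp y) (?perp y)" unfolding n[symmetric] by (rule pythagoras)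
  have perp: "ip V (?perp y) (?perp y) \<le> l2\<^sup>2 * ip V (?perp x) (?perp x)"
    unfolding y_def using ip_B_perp_le l2 by auto
  have "\<epsilon> * ip V (A y) y \<le> f * ip V x x" if \<epsilon>: "\<epsilon> = 1 \<or> \<epsilon> = -1" for \<epsilon>
  proof -
    have zl: "\<epsilon> * ip V (A (proj y)) (proj y) \<le> l1 * ip V (proj y) (proj y)"
      using ip_A_proj_le[OF l1(1) y0] \<epsilon> by auto
    consider "l2 = 0" | "l2 = 1" | "0 < l2" "l2 < 1" using l2 by force
    then show ?thesis
    proof cases
      case 1
      have "ip V (?perp y) (?perp y) = 0" using perp 1 ip_nonneg[of V "?perp y"] by simp
      then have "y e = proj y e" if "e \<in> V" for e
        using that finite_V by (auto simp: ip_def sum_nonneg_eq_0_iff)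
      then have "ip V (A y) y = ip V (A (proj y)) (proj y)"
        by (intro ip_cong A_cong) auto
      then have "\<epsilon> * ip V (A y) y \<le> l1 * n" using zl n by simp
      also have "l1 = f" using 1 l1 by (simp add: f_def f_bound_def)
      also have "f * n \<le> f * ip V x x"
        using f0 x_split ip_nonneg[of V "?perp x"] by (intro mult_left_mono) auto
      finally show ?thesis .
    next
      case 2
      have "\<epsilon> * ip V (A y) y \<le> nrm (A y) * nrm y"
        using \<epsilon> ip_le_L2_set[of V "A y" y] ip_le_L2_set[of V "\<lambda>v. (-1) * A y v" y]
        unfolding ip_scale by (auto simp: L2_set_def)
      also have "\<dots> = ip V y y" by (simp add: nrm_A L2_set_power2 flip: power2_eq_square)
      also have "\<dots> \<le> ip V x x" unfolding y_def by (rule ip_B_le)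
      also have "f = 1" using 2 by (simp add: f_def f_bound_def)
      then have "ip V x x = f * ip V x x" by simp
      finally show ?thesis .
    next
      case 3
      have "l2 * l2 < l2 * 1" using 3 by (intro mult_strict_left_mono) auto
      with f0 3 have "l2\<^sup>2 < f" "l2\<^sup>2 \<le> 1" unfolding power2_eq_square by linarith+
      have "\<epsilon> * l2\<^sup>2 * ip V (A y) y \<le> f * ip V y y - (1 - l2\<^sup>2) * f * n"
        unfolding n[symmetric] A_def
        using f_bound_root[of l1 l2] \<open>l2\<^sup>2 < f\<close> \<open>l2\<^sup>2 \<le> 1\<close> \<epsilon> ip_proj_proj[of y y] zl[unfolded A_def]
        unfolding f_def[symmetric] by (intro involution_form_le rot1) simp_all
      \<comment> \<open>The deficit (1 - l2^2) f n leaves the weight l2^2 f on n, matching the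
        factor that \<open>perp\<close> gives for the rest.\<close>
      also have "\<dots> = f * ip V (?perp y) (?perp y) + l2\<^sup>2 * (f * n)"
        unfolding y_split by (simp add: algebra_simps)
      also have "\<dots> \<le> f * (l2\<^sup>2 * ip V (?perp x) (?perp x)) + l2\<^sup>2 * (f * n)"
        using perp f0 by (simp add: mult_left_mono)
      also have "\<dots> = l2\<^sup>2 * (f * ip V x x)" unfolding x_split by (simp add: algebra_simps)
      finally have "l2\<^sup>2 * (\<epsilon> * ip V (A y) y) \<le> l2\<^sup>2 * (f * ip V x x)" by (simp add: mult_ac)
      with 3 show ?thesis by simp
    qed
  qed
  from this[of 1] this[of "-1"] show ?thesis by (simp add: y_def f_def abs_le_iff)
qed

lemma nrm_BAB_le:
  assumes l1: "second_eigenvalue G1 \<le> l1" "l1 \<in> {0..1}" and l2: "second_eigenvalue G2 \<le> l2" "l2 \<in> {0..1}"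
    and x: "sum x V = 0"
  shows "nrm (B (A (B x))) \<le> f_bound l1 l2 * nrm x"
proof (rule symmetric_norm_le[where T = "\<lambda>x. B (A (B x))"])
  show "B (A (B (\<lambda>v. a * x v + b * y v))) v = a * B (A (B x)) v + b * B (A (B y)) v" for a b x y v
    unfolding B_linear A_linear B_linear[abs_def] A_linear[abs_def] ..
  show "ip V (B (A (B x))) y = ip V x (B (A (B y)))" for x y
    by (simp only: A_sym B_sym)
  show "sum (B (A (B x))) V = 0" if "sum x V = 0" for x
    using that by (simp add: sum_A sum_B)
  show "\<bar>ip V (B (A (B x))) x\<bar> \<le> f_bound l1 l2 * ip V x x" if "sum x V = 0" for x
    unfolding B_sym[of "A (B x)"] using assms(1-4) that by (rule BAB_form_le)
qed (use f_bound_ge l1 l2 x in auto)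

text \<open>Of the words in \<open>A\<close> and \<open>B\<close> in the expansion of \<open>(D B + A)\<^sup>3\<close> only \<open>B A B\<close>, with coefficient
  \<open>D\<^sup>2\<close>, needs a bound better than 1; the other words are collected into three contractions.\<close>

lemma nrm_cube_le:
  assumes f: "nrm (B (A (B x))) \<le> f * nrm x"
  defines "S \<equiv> \<lambda>x e. D * B x e + A x e"
  shows "nrm (S (S (S x))) \<le> ((D + 1) ^ 3 - D\<^sup>2 + D\<^sup>2 * f) * nrm x"
proof -
  have D0: "D \<ge> 0" by simp
  have S_apply: "S y e = D * B y e + A y e" for y e by (simp add: S_def)
  have scale: "nrm (\<lambda>e. c * y e) = c * nrm y" if "c \<ge> 0" for c y
    using that by (rule L2_set_scale)
  have S: "nrm (S y) \<le> (D + 1) * nrm y" for y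
  proof -
    have "nrm (S y) \<le> nrm (\<lambda>e. D * B y e) + nrm (A y)"
      unfolding S_def by (rule L2_set_triangle_ineq)
    also have "\<dots> \<le> (D + 1) * nrm y"
      using mult_left_mono[OF nrm_B D0, of y] by (simp add: scale nrm_A algebra_simps)
    finally show ?thesis .
  qed
  have SS: "nrm (S (S x)) \<le> (D + 1) * ((D + 1) * nrm x)"
    by (rule order_trans[OF S mult_left_mono[OF S]]) simp
  \<comment> \<open>Only words beginning with B A are split completely. Apart from B A B, the three
    terms have norms at most D^2 (D + 1), D and (D + 1)^2 times that of x, and these add up to (D +
    1)^3 - D^2.\<close>
  have eq: "S (S (S x)) = (\<lambda>e. ((D\<^sup>2 * B (B (S x)) e + D * B (A (A x)) e) + D\<^sup>2 * B (A (B x)) e) + A (S (S x)) e)"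
  proof
    fix e
    have "S (S x) = (\<lambda>e. D * B (S x) e + 1 * A (S x) e)"
      by (simp add: S_apply fun_eq_iff)
    then have "B (S (S x)) e = D * B (B (S x)) e + 1 * B (A (S x)) e"
      by (simp only: B_linear)
    moreover have "A (S x) = (\<lambda>e. D * A (B x) e + 1 * A (A x) e)"
      by (simp add: S_def A_def)
    ultimately have "B (S (S x)) e = D * B (B (S x)) e + (D * B (A (B x)) e + B (A (A x)) e)"
      using B_linear[of D "A (B x)" 1 "A (A x)" e] by simp
    then show "S (S (S x)) e = ((D\<^sup>2 * B (B (S x)) e + D * B (A (A x)) e) + D\<^sup>2 * B (A (B x)) e) + A (S (S x)) e"
      by (subst S_apply) (simp add: algebra_simps power2_eq_square)
  qed
  have "nrm (S (S (S x))) \<le>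
      nrm (\<lambda>e. (D\<^sup>2 * B (B (S x)) e + D * B (A (A x)) e) + D\<^sup>2 * B (A (B x)) e) + nrm (A (S (S x)))"
    unfolding eq by (rule L2_set_triangle_ineq)
  also have "nrm (\<lambda>e. (D\<^sup>2 * B (B (S x)) e + D * B (A (A x)) e) + D\<^sup>2 * B (A (B x)) e) \<le>
      nrm (\<lambda>e. D\<^sup>2 * B (B (S x)) e + D * B (A (A x)) e) + nrm (\<lambda>e. D\<^sup>2 * B (A (B x)) e)"
    by (rule L2_set_triangle_ineq)
  also have "nrm (\<lambda>e. D\<^sup>2 * B (B (S x)) e + D * B (A (A x)) e) \<le>
      nrm (\<lambda>e. D\<^sup>2 * B (B (S x)) e) + nrm (\<lambda>e. D * B (A (A x)) e)"
    by (rule L2_set_triangle_ineq)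
  also have "nrm (\<lambda>e. D\<^sup>2 * B (B (S x)) e) \<le> D\<^sup>2 * ((D + 1) * nrm x)"
    using order_trans[OF nrm_B order_trans[OF nrm_B S], of x] by (simp add: scale mult_left_mono)
  also have "nrm (\<lambda>e. D * B (A (A x)) e) \<le> D * nrm x"
    using nrm_B[of "A (A x)"] by (simp add: scale mult_left_mono nrm_A)
  also have "nrm (\<lambda>e. D\<^sup>2 * B (A (B x)) e) \<le> D\<^sup>2 * (f * nrm x)"
    using f by (simp add: scale mult_left_mono)
  also have "nrm (A (S (S x))) \<le> (D + 1) * ((D + 1) * nrm x)"
    using SS by (simp add: nrm_A)
  finally show ?thesis by (simp add: algebra_simps power2_eq_square power3_eq_cube)
qed

lemma second_eigenvalue_replacement_le:
  assumes l1: "second_eigenvalue G1 \<le> l1" "l1 \<in> {0..1}" and l2: "second_eigenvalue G2 \<le> l2" "l2 \<in> {0..1}"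
  defines "p \<equiv> D\<^sup>2 / (D + 1) ^ 3"
  shows "second_eigenvalue (replacement_product G1 G2) \<le> ((1 - p) + p * f_bound l1 l2) powr (1 / 3)"
proof (rule second_eigenvalue_le[OF regular_replacement])
  define f where "f = f_bound l1 l2"
  define c where "c = (1 - p) + p * f"
  fix x :: "'v \<times> nat \<Rightarrow> real" assume "sum x (verts (replacement_product G1 G2)) = 0"
  then have x: "sum x V = 0" by (simp add: verts_replacement)
  define M where "M = adj_mult (replacement_product G1 G2)"
  define S where "S = (\<lambda>x e. D * B x e + A x e)"
  define \<kappa> where "\<kappa> = 1 / (D + 1)"
  have M: "M y e = \<kappa> * S y e" if "e \<in> V" for y e
    using adj_mult_replacement[OF that, of y] by (simp add: S_def M_def \<kappa>_def field_simps)
  \<comment> \<open>The identity M = \<kappa> S is available on \<open>V\<close> only, so scalars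
    are pulled out pointwise, through congruence of A and B on \<open>V\<close>.\<close>
  have S_scale: "S y e = \<kappa> * S z e" if "\<And>e. e \<in> V \<Longrightarrow> y e = \<kappa> * z e" "e \<in> V" for y z e
  proof -
    \<comment> \<open>The term \<open>0 * z e\<close> fits the scaled vector to the two-summand form
      of linearity.\<close>
    have "B y e = B (\<lambda>e. \<kappa> * z e + 0 * z e) e" "A y e = A (\<lambda>e. \<kappa> * z e + 0 * z e) e"
      by (rule B_cong A_cong; use that in simp)+
    then show ?thesis unfolding B_linear A_linear by (simp add: S_def algebra_simps)
  qed
  have M3: "M (M (M x)) e = \<kappa> ^ 3 * S (S (S x)) e" if "e \<in> V" for e
  proof -
    have 1: "S (M y) e = \<kappa> * S (S y) e" if "e \<in> V" for y e
      using M that by (rule S_scale)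
    have 2: "S (S (M y)) e = \<kappa> * S (S (S y)) e" if "e \<in> V" for y e
      using 1 that by (rule S_scale)
    show ?thesis by (simp add: M[OF that] 1[OF that] 2[OF that] power3_eq_cube)
  qed
  have \<kappa>: "\<kappa> ^ 3 * ((D + 1) ^ 3 - D\<^sup>2 + D\<^sup>2 * f) = c"
  proof -
    have "\<kappa> ^ 3 * (D + 1) ^ 3 = 1" "\<kappa> ^ 3 * D\<^sup>2 = p"
      by (simp_all add: \<kappa>_def p_def power_divide)
    then show ?thesis unfolding c_def by (simp add: algebra_simps flip: mult.assoc)
  qed
  have "nrm (M (M (M x))) = \<kappa> ^ 3 * nrm (S (S (S x)))"
    using L2_set_scale[of "\<kappa> ^ 3" "S (S (S x))" V]
    by (simp add: M3 \<kappa>_def cong: L2_set_cong)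
  also have "\<dots> \<le> \<kappa> ^ 3 * (((D + 1) ^ 3 - D\<^sup>2 + D\<^sup>2 * f) * nrm x)"
    unfolding S_def f_def by (intro mult_left_mono nrm_cube_le nrm_BAB_le assms x) (simp add: \<kappa>_def)
  finally have M3_le: "nrm (M (M (M x))) \<le> c * nrm x"
    by (simp add: \<kappa> flip: mult.assoc)
  have "nrm (M x) ^ 3 \<le> nrm (M (M (M x))) * nrm x ^ 2"
    by (rule symmetric_norm_cube_le)
      (use ip_adj_mult_sym[OF regular_replacement] in \<open>simp add: M_def verts_replacement\<close>)
  also have "\<dots> \<le> (c * nrm x) * nrm x ^ 2"
    using M3_le by (rule mult_right_mono) simp
  finally have cube: "nrm (M x) ^ 3 \<le> c * nrm x ^ 3"
    by (simp add: power3_eq_cube power2_eq_square mult.assoc)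
  have "nrm (M x) \<le> c powr (1 / 3) * nrm x"
  proof (cases "nrm x = 0")
    case True
    with cube show ?thesis by (simp add: L2_set_nonneg)
  next
    case False
    then have pos: "nrm x > 0" using L2_set_nonneg[of x V] by linarith
    let ?q = "nrm (M x) / nrm x"
    have q: "?q \<ge> 0" by (simp add: L2_set_nonneg)
    have "?q ^ 3 \<le> c" using cube pos by (simp add: power_divide divide_le_eq)
    then have "(?q ^ 3) powr (1 / 3) \<le> c powr (1 / 3)"
      using q by (intro powr_mono2) auto
    also have "(?q ^ 3) powr (1 / 3) = ?q"
      using q by (cases "?q = 0") (simp_all add: powr_powr flip: powr_numeral)
    finally show ?thesis using pos by (simp add: divide_le_eq)
  qed
  then show "L2_set (adj_mult (replacement_product G1 G2) x) (verts (replacement_product G1 G2))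
      \<le> ((1 - p) + p * f_bound l1 l2) powr (1 / 3) * L2_set x (verts (replacement_product G1 G2))"
    by (simp add: verts_replacement M_def c_def f_def)
qed simp

end

section \<open>The bound below 1 and the assembled statement\<close>

lemma replacement_bound_less_1:
  fixes D2 :: nat
  assumes "l1 \<in> {0..<1}" "l2 \<in> {0..<1}" "D2 \<ge> 1"
  defines "p \<equiv> real D2 ^ 2 / (real D2 + 1) ^ 3"
  shows "((1 - p) + p * f_bound l1 l2) powr (1 / 3) < 1"
proof -
  have f: "f_bound l1 l2 < 1" "0 \<le> f_bound l1 l2"
    using f_bound_less_1 f_bound_ge assms by auto
  have "real D2 ^ 2 \<le> (real D2 + 1) ^ 3"
    by (simp add: power2_eq_square power3_eq_cube algebra_simps)
  \<comment> \<open>D2 >= 1 makes p positive, so that f < 1 pulls the convex combination of 1 and f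
    strictly below 1.\<close>
  then have p: "0 < p" "p \<le> 1" using assms(3) by (simp_all add: p_def divide_le_eq)
  have "0 \<le> (1 - p) + p * f_bound l1 l2" using p f by simp
  moreover have "p * f_bound l1 l2 < p * 1" using p f by (intro mult_strict_left_mono) auto
  ultimately show ?thesis using powr_less_mono2[of "1 / 3" "(1 - p) + p * f_bound l1 l2" 1] by simp
qed

lemma NDl_replacement:
  assumes "NDl_graph N1 D1 l1 G1" "NDl_graph D1 D2 l2 G2" "verts G2 = {1..D1}"
    and "l1 \<in> {0..1}" "l2 \<in> {0..1}"
  defines "p \<equiv> real D2 ^ 2 / (real D2 + 1) ^ 3"
  shows "NDl_graph (N1 * D1) (D2 + 1) (((1 - p) + p * f_bound l1 l2) powr (1 / 3)) (replacement_product G1 G2)"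
proof -
  interpret replacement G1 G2
    by unfold_locales (use assms in \<open>auto simp: NDl_graph_def\<close>)
  show ?thesis
    using assms regular_replacement second_eigenvalue_replacement_le[of l1 l2]
    by (auto simp: NDl_graph_def verts_replacement deg_replacement card_cartesian_product)
qed

theorem theorem6p4:
  shows "(\<exists>g :: real \<Rightarrow> real \<Rightarrow> nat \<Rightarrow> real.
      \<forall>l1 \<in> {0..1}. \<forall>l2 \<in> {0..1}. \<forall>D2 \<ge> 1.
        (\<forall>N1 D1 (G1 :: nat rgraph) (G2 :: nat rgraph).
           NDl_graph N1 D1 l1 G1 \<and> verts G1 = {1..N1} \<and>
           NDl_graph D1 D2 l2 G2 \<and> verts G2 = {1..D1} \<longrightarrow>
           NDl_graph (N1 * D1) (D2 + 1) (g l1 l2 D2) (replacement_product G1 G2)) \<and>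
        (let p = real D2 ^ 2 / (real D2 + 1) ^ 3
         in g l1 l2 D2 \<le> ((1 - p) + p * f_bound l1 l2) powr (1 / 3)) \<and>
        (l1 < 1 \<and> l2 < 1 \<longrightarrow> g l1 l2 D2 < 1)) \<and>
    (\<exists>P F. polynomial3 F \<and>
      (\<forall>N1 D1 D2 (G1 :: nat rgraph) (G2 :: nat rgraph).
         regular_graph G1 \<and> verts G1 = {1..N1} \<and> deg G1 = D1 \<and>
         regular_graph G2 \<and> verts G2 = {1..D1} \<and> deg G2 = D2 \<longrightarrow>
         (\<forall>v \<in> {1..N1}. \<forall>k \<in> {1..D1}. \<forall>i \<in> {1..D2 + 1}. \<forall>w m j.
            rot (replacement_product G1 G2) ((v, k), i) = ((w, m), j) \<longrightarrow>
            (\<exists>t. computes (rot_oracles G1 G2) P [N1, D1, D2, v, k, i] [w, m, j] t 1 \<and>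
                 real t \<le> F (log 2 (real N1)) (log 2 (real D1)) (log 2 (real D2))))))"
\<comment> \<open>The function g is taken to be the upper bound itself, so its inequality holds with
  equality and the content lies in \<open>NDl_replacement\<close>.\<close>
proof (intro conjI replacement_program_polynomial
    exI[of _ "\<lambda>l1 l2 D2. let p = real D2 ^ 2 / (real D2 + 1) ^ 3
      in ((1 - p) + p * f_bound l1 l2) powr (1 / 3)"] ballI allI impI)
  fix l1 l2 :: real and D2 :: nat
  assume l: "l1 \<in> {0..1}" "l2 \<in> {0..1}" and D2: "D2 \<ge> 1"
  let ?g = "let p = real D2 ^ 2 / (real D2 + 1) ^ 3 in ((1 - p) + p * f_bound l1 l2) powr (1 / 3)"
  show "NDl_graph (N1 * D1) (D2 + 1) ?g (replacement_product G1 G2)"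
    if "NDl_graph N1 D1 l1 G1 \<and> verts G1 = {1..N1} \<and> NDl_graph D1 D2 l2 G2 \<and> verts G2 = {1..D1}"
    for N1 D1 and G1 G2 :: "nat rgraph"
    unfolding Let_def using that l by (intro NDl_replacement) auto
  show "let p = real D2 ^ 2 / (real D2 + 1) ^ 3 in ?g \<le> ((1 - p) + p * f_bound l1 l2) powr (1 / 3)"
    by (simp add: Let_def)
  show "?g < 1" if "l1 < 1 \<and> l2 < 1"
    unfolding Let_def using that l D2 by (intro replacement_bound_less_1) auto
qed

end
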